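(* Let $2\le k\le n$, $\sigma\in S^k_n$, $C\in\mathbb{S}^{k-1,\sigma}_{>0}$, and consider the $\mathcal{M}^C_{k,\sigma}$-leaf parametric normal form with $s=1$, i.e. with amplitude dynamics $\dot\rho_{\sigma(k)}=\rho_{\sigma(k)}(\nu_0+a_1\rho_{\sigma(k)}^2)$, $a_1\ne0$. Then there is a leaf-dependent bifurcation of an invariant $\mathbb{T}_k$-torus from the origin. This leaf-bifurcation is three-determined and its associated bifurcation variety is $T_{Pch}=\{\nu_0:\nu_0=0\}$. When $\nu_0>0$ and $a_1<0$, the invariant torus is stable while the origin is unstable. For $a_1>0$ and $\nu_0<0$, the origin is stable and the $\mathbb{T}_k$-torus is repelling.
   Context: $S^k_n$ is the set of permutations $\sigma$ of $\{1,\dots,n\}$ with $\sigma(i)<\sigma(j)$ for $i<j\le k$ and for $k<i<j\le n$. $\mathbb{S}^{k-1,\sigma}_{>0}=\{(c_1,\dots,c_n):\sum_{i\le k}c_{\sigma(i)}^2=1,\ c_{\sigma(i)}>0\ (i\le k),\ c_{\sigma(i)}=0\ (i>k)\}$. With $(\rho_i,\theta_i)$ polar coordinates of $(x_i,y_i)$, the leaf $\mathcal{M}^C_{k,\sigma}\subset\mathbb{R}^{2n}$ is the set where $\rho_{\sigma(i)}=\frac{c_{\sigma(i)}}{c_{\sigma(k)}}\rho_{\sigma(k)}>0$ for $i\le k$ and $(x_{\sigma(i)},y_{\sigma(i)})=0$ for $i>k$ (its closure contains the origin); it is homeomorphic to $\mathbb{T}_k\times\mathbb{R}^+$. For a natural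 number $s$, the leaf parametric normal form on $\mathcal{M}^C_{k,\sigma}$ is the system, for $1\le i\le k$, $$\dot\rho_{\sigma(i)}=\rho_{\sigma(i)}\sum_{j=0}^{s}\nu_j\rho_{\sigma(k)}^{2j},\qquad \dot\theta_{\sigma(i)}=\omega_{\sigma(i)}+\sum_{j=0}^s\hat b^i_j\,\rho_{\sigma(k)}^{2j},$$ where $\nu_s=a_s\ne0$ is constant, $\nu_0,\dots,\nu_{s-1}$ are small real unfolding parameters (the coefficients $\hat a_j(\mu,C)$, vanishing at $\mu=0$), $\hat b^i_j$ depend on the parameters with $\hat b^i_0=0$ at $\mu=0$, all $\omega_i\neq 0$ and $\omega_i/\omega_j\notin\mathbb{Q}$ for $i<j$. An invariant $\mathbb{T}_k$-torus ($k$-hypertorus) on the leaf is $\{\rho_{\sigma(k)}=r\}$ with $r>0$ a zero of the amplitude equation. Stability refers to the dynamics on the leaf. A leaf-bifurcation variety is the set of parameters where the qualitative dynamics on the leaf changes. A bifurcation is $m$-determined if the qualitative local dynamics of the amplitude equation is determined by its terms of degree $\le m$ in $\rho_{\sigma(k)}$, i.e. is unaffected by perturbation terms of higher degree. *)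

theory Defs
  imports "HOL-Analysis.Analysis"
begin

text \<open>
  A point of \<open>\<real>\<^sup>2\<^sup>n\<close> is a function sending the index \<open>i\<close> to \<open>(x\<^sub>i, y\<^sub>i)\<close>, equal to \<open>0\<close> at every index
  outside \<open>{1..n}\<close>. On such functions the product topology of \<^typ>\<open>nat \<Rightarrow> real \<times> real\<close> is the
  Euclidean topology of \<open>\<real>\<^sup>2\<^sup>n\<close>. Since the norm of a pair is Euclidean, the polar radius \<open>\<rho>\<^sub>i\<close> of the
  point \<open>z\<close> is \<open>norm (z i)\<close>.
\<close>

type_synonym state = "nat \<Rightarrow> real \<times> real"

definition origin :: state where
  "origin = (\<lambda>_. 0)"

section \<open>Leaves\<close>

definition shuffle_perms :: "nat \<Rightarrow> nat \<Rightarrow> (nat \<Rightarrow> nat) set" where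
  "shuffle_perms n k = {\<sigma>. \<sigma> permutes {1..n} \<and>
     (\<forall>i\<in>{1..n}. \<forall>j\<in>{1..n}. i < j \<and> (j \<le> k \<or> k < i) \<longrightarrow> \<sigma> i < \<sigma> j)}"

definition pos_sphere :: "nat \<Rightarrow> nat \<Rightarrow> (nat \<Rightarrow> nat) \<Rightarrow> (nat \<Rightarrow> real) set" where
  "pos_sphere n k \<sigma> = {c. (\<Sum>i=1..k. (c (\<sigma> i))\<^sup>2) = 1 \<and> (\<forall>i\<in>{1..k}. c (\<sigma> i) > 0) \<and>
     (\<forall>i\<in>{k<..n}. c (\<sigma> i) = 0) \<and> (\<forall>i. i \<notin> {1..n} \<longrightarrow> c i = 0)}"

definition leaf :: "nat \<Rightarrow> nat \<Rightarrow> (nat \<Rightarrow> nat) \<Rightarrow> (nat \<Rightarrow> real) \<Rightarrow> state set" where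
  "leaf n k \<sigma> c = {z.
     (\<forall>i\<in>{1..k}. norm (z (\<sigma> i)) = c (\<sigma> i) / c (\<sigma> k) * norm (z (\<sigma> k)) \<and> norm (z (\<sigma> i)) > 0) \<and>
     (\<forall>i\<in>{k<..n}. z (\<sigma> i) = 0) \<and> (\<forall>i. i \<notin> {1..n} \<longrightarrow> z i = 0)}"

text \<open>The phase space: the leaf together with the origin, which is its closure.\<close>

definition closed_leaf :: "nat \<Rightarrow> nat \<Rightarrow> (nat \<Rightarrow> nat) \<Rightarrow> (nat \<Rightarrow> real) \<Rightarrow> state set" where
  "closed_leaf n k \<sigma> c = insert origin (leaf n k \<sigma> c)"

section \<open>The leaf parametric normal form\<close>

text \<open>A dynamical system is given by its predicate ``\<open>z\<close> is a solution on the time interval \<open>I\<close>''.\<close>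

type_synonym 'x system = "real set \<Rightarrow> (real \<Rightarrow> 'x) \<Rightarrow> bool"

text \<open>
  The coefficients are \<open>\<nu> 0, \<dots>, \<nu> s\<close> (with \<open>\<nu> s = a\<^sub>s\<close>), the frequencies \<open>\<omega>\<close>, and \<open>b i j\<close>
  for the \<open>j\<close>-th phase coefficient of the angle with index \<open>\<sigma> i\<close>. The polar form is required with
  \<open>\<rho> \<ge> 0\<close>, so that the motions on the leaf and the rest point at the origin are both covered.
\<close>

definition leaf_normal_form ::
  "nat \<Rightarrow> nat \<Rightarrow> (nat \<Rightarrow> nat) \<Rightarrow> (nat \<Rightarrow> real) \<Rightarrow> nat \<Rightarrow> (nat \<Rightarrow> real) \<Rightarrow> (nat \<Rightarrow> real)
    \<Rightarrow> (nat \<Rightarrow> nat \<Rightarrow> real) \<Rightarrow> state system" where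
  "leaf_normal_form n k \<sigma> c s \<nu> \<omega> b I z \<longleftrightarrow>
     (\<forall>t\<in>I. z t \<in> closed_leaf n k \<sigma> c) \<and>
     (\<exists>\<rho> \<theta> :: nat \<Rightarrow> real \<Rightarrow> real. \<forall>i\<in>{1..k}. \<forall>t\<in>I.
        \<rho> (\<sigma> i) t \<ge> 0 \<and>
        z t (\<sigma> i) = (\<rho> (\<sigma> i) t * cos (\<theta> (\<sigma> i) t), \<rho> (\<sigma> i) t * sin (\<theta> (\<sigma> i) t)) \<and>
        (\<rho> (\<sigma> i) has_real_derivative
           \<rho> (\<sigma> i) t * (\<Sum>j=0..s. \<nu> j * \<rho> (\<sigma> k) t ^ (2 * j))) (at t within I) \<and>
        (\<theta> (\<sigma> i) has_real_derivative
           \<omega> (\<sigma> i) + (\<Sum>j=0..s. b i j * \<rho> (\<sigma> k) t ^ (2 * j))) (at t within I))"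

definition amplitude :: "nat \<Rightarrow> (nat \<Rightarrow> real) \<Rightarrow> real \<Rightarrow> real" where
  "amplitude s \<nu> r = r * (\<Sum>j=0..s. \<nu> j * r ^ (2 * j))"

definition hypertorus :: "nat \<Rightarrow> nat \<Rightarrow> (nat \<Rightarrow> nat) \<Rightarrow> (nat \<Rightarrow> real) \<Rightarrow> real \<Rightarrow> state set" where
  "hypertorus n k \<sigma> c r = {z \<in> leaf n k \<sigma> c. norm (z (\<sigma> k)) = r}"

definition invariant_tori ::
  "nat \<Rightarrow> nat \<Rightarrow> (nat \<Rightarrow> nat) \<Rightarrow> (nat \<Rightarrow> real) \<Rightarrow> nat \<Rightarrow> (nat \<Rightarrow> real) \<Rightarrow> state set set" where
  "invariant_tori n k \<sigma> c s \<nu> = {hypertorus n k \<sigma> c r | r. r > 0 \<and> amplitude s \<nu> r = 0}"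

text \<open>
  The case \<open>s = 1\<close>, with unfolding parameter \<open>\<nu>0\<close>; the phase coefficients \<open>b i j \<nu>0\<close> may depend on
  the parameter.
\<close>

definition coeffs1 :: "real \<Rightarrow> real \<Rightarrow> nat \<Rightarrow> real" where
  "coeffs1 a1 \<nu>0 j = (if j = 0 then \<nu>0 else a1)"

definition leaf_normal_form1 ::
  "nat \<Rightarrow> nat \<Rightarrow> (nat \<Rightarrow> nat) \<Rightarrow> (nat \<Rightarrow> real) \<Rightarrow> real \<Rightarrow> (nat \<Rightarrow> real)
    \<Rightarrow> (nat \<Rightarrow> nat \<Rightarrow> real \<Rightarrow> real) \<Rightarrow> real \<Rightarrow> state system" where
  "leaf_normal_form1 n k \<sigma> c a1 \<omega> b \<nu>0 =
     leaf_normal_form n k \<sigma> c 1 (coeffs1 a1 \<nu>0) \<omega> (\<lambda>i j. b i j \<nu>0)"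

section \<open>Invariance and stability relative to the phase space of a system\<close>

definition flow_invariant :: "'x system \<Rightarrow> 'x set \<Rightarrow> bool" where
  "flow_invariant sol A \<longleftrightarrow>
     (\<forall>I z. is_interval I \<and> sol I z \<and> (\<exists>t\<in>I. z t \<in> A) \<longrightarrow> (\<forall>t\<in>I. z t \<in> A))"

definition lyapunov_stable :: "'x::topological_space system \<Rightarrow> 'x set \<Rightarrow> bool" where
  "lyapunov_stable sol A \<longleftrightarrow>
     (\<forall>U. open U \<and> A \<subseteq> U \<longrightarrow> (\<exists>V. open V \<and> A \<subseteq> V \<and>
        (\<forall>T\<ge>0. \<forall>z. sol {0..T} z \<and> z 0 \<in> V \<longrightarrow> z T \<in> U)))"

text \<open>
  \<open>X\<close> is the phase space; motions near \<open>A\<close> are required to exist for all positive time. For the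
  compact sets \<open>A\<close> considered here, being eventually in every neighbourhood of \<open>A\<close> means that the
  distance to \<open>A\<close> tends to \<open>0\<close>.
\<close>

definition attracting :: "'x::topological_space set \<Rightarrow> 'x system \<Rightarrow> 'x set \<Rightarrow> bool" where
  "attracting X sol A \<longleftrightarrow>
     (\<exists>V. open V \<and> A \<subseteq> V \<and> (\<forall>p\<in>V \<inter> X.
        (\<exists>z. sol {0..} z \<and> z 0 = p) \<and>
        (\<forall>z. sol {0..} z \<and> z 0 = p \<longrightarrow>
           (\<forall>U. open U \<and> A \<subseteq> U \<longrightarrow> (\<forall>\<^sub>F t in at_top. z t \<in> U)))))"

definition asymptotically_stable :: "'x::topological_space set \<Rightarrow> 'x system \<Rightarrow> 'x set \<Rightarrow> bool" where
  "asymptotically_stable X sol A \<longleftrightarrow> lyapunov_stable sol A \<and> attracting X sol A"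

definition time_reversal :: "'x system \<Rightarrow> 'x system" where
  "time_reversal sol I z = sol (uminus ` I) (\<lambda>t. z (- t))"

definition repelling :: "'x::topological_space set \<Rightarrow> 'x system \<Rightarrow> 'x set \<Rightarrow> bool" where
  "repelling X sol A \<longleftrightarrow> asymptotically_stable X (time_reversal sol) A"

section \<open>Bifurcations on a leaf\<close>

text \<open>
  Torus \<open>T \<nu>\<close> is born at the origin as the parameter enters one side \<open>S\<close> of \<open>0\<close>: on \<open>S\<close> it is the only
  invariant hypertorus of the leaf, off \<open>S\<close> there is none, and \<open>T \<nu>\<close> shrinks to the origin as
  \<open>\<nu> \<rightarrow> 0\<close> in \<open>S\<close>. The arguments \<open>\<tau> \<nu>\<close> and \<open>sol \<nu>\<close> are the set of invariant hypertori and the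
  system at parameter \<open>\<nu>\<close>.
\<close>

definition torus_bifurcation_from_origin ::
  "(real \<Rightarrow> state set set) \<Rightarrow> (real \<Rightarrow> state system) \<Rightarrow> bool" where
  "torus_bifurcation_from_origin \<tau> sol \<longleftrightarrow>
     (\<exists>S T. (S = {0<..} \<or> S = {..<0}) \<and>
        (\<forall>\<nu>\<in>S. \<tau> \<nu> = {T \<nu>} \<and> flow_invariant (sol \<nu>) (T \<nu>)) \<and>
        (\<forall>\<nu>. \<nu> \<notin> S \<longrightarrow> \<tau> \<nu> = {}) \<and>
        (\<forall>U. open U \<and> origin \<in> U \<longrightarrow> (\<forall>\<^sub>F \<nu> in at 0 within S. T \<nu> \<subseteq> U)))"

text \<open>
  The qualitative dynamics on a leaf is the oriented orbit structure up to homeomorphism and up to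
  position on the hypertori \<open>\<rho> = const\<close>: a point \<open>q\<close> counts as reached from \<open>p\<close> if the orbit of \<open>p\<close>
  reaches in nonnegative time the hypertorus through \<open>q\<close>. (Without passing to hypertori, every change of the
  frequencies would count as a bifurcation.)
  As reaching in both directions means lying on the same hypertorus, the equivalence below
  maps hypertori to hypertori, invariant ones to invariant ones, and respects the direction of time.
\<close>

definition torus_reach :: "nat \<Rightarrow> (nat \<Rightarrow> nat) \<Rightarrow> state system \<Rightarrow> state \<Rightarrow> state \<Rightarrow> bool" where
  "torus_reach k \<sigma> sol p q \<longleftrightarrow>
     (\<exists>T\<ge>0. \<exists>z. sol {0..T} z \<and> z 0 = p \<and> norm (z T (\<sigma> k)) = norm (q (\<sigma> k)))"

definition leaf_equivalent ::
  "nat \<Rightarrow> nat \<Rightarrow> (nat \<Rightarrow> nat) \<Rightarrow> (nat \<Rightarrow> real) \<Rightarrow> state system \<Rightarrow> state system \<Rightarrow> bool" where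
  "leaf_equivalent n k \<sigma> c sol sol' \<longleftrightarrow>
     (\<exists>h h'. homeomorphism (closed_leaf n k \<sigma> c) (closed_leaf n k \<sigma> c) h h' \<and>
        (\<forall>p\<in>closed_leaf n k \<sigma> c. \<forall>q\<in>closed_leaf n k \<sigma> c.
           torus_reach k \<sigma> sol p q \<longleftrightarrow> torus_reach k \<sigma> sol' (h p) (h q)))"

definition leaf_bifurcation_variety ::
  "nat \<Rightarrow> nat \<Rightarrow> (nat \<Rightarrow> nat) \<Rightarrow> (nat \<Rightarrow> real) \<Rightarrow> ('p::metric_space \<Rightarrow> state system) \<Rightarrow> 'p set" where
  "leaf_bifurcation_variety n k \<sigma> c sol =
     {\<nu>. \<forall>\<epsilon>>0. \<exists>\<nu>'. dist \<nu>' \<nu> < \<epsilon> \<and> \<not> leaf_equivalent n k \<sigma> c (sol \<nu>) (sol \<nu>')}"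

section \<open>Finite determinacy of the amplitude equation\<close>

definition scalar_reach :: "(real \<Rightarrow> real) \<Rightarrow> real set \<Rightarrow> real \<Rightarrow> real \<Rightarrow> bool" where
  "scalar_reach f X x y \<longleftrightarrow>
     (\<exists>T\<ge>0. \<exists>u. u 0 = x \<and> u T = y \<and>
        (\<forall>t\<in>{0..T}. u t \<in> X \<and> (u has_real_derivative f (u t)) (at t within {0..T})))"

text \<open>
  Local topological equivalence, at \<open>r = 0\<close> in \<open>[0, \<infinity>)\<close> and parameter \<open>0\<close>, of the families
  \<open>r' = F \<nu> r\<close> and \<open>r' = G \<nu> r\<close>: the neighbourhoods do not depend on the parameter.
\<close>

definition locally_equivalent_families :: "(real \<Rightarrow> real \<Rightarrow> real) \<Rightarrow> (real \<Rightarrow> real \<Rightarrow> real) \<Rightarrow> bool" where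
  "locally_equivalent_families F G \<longleftrightarrow>
     (\<exists>\<delta>>0. \<exists>\<delta>'>0. \<exists>\<epsilon>>0. \<forall>\<nu>. \<bar>\<nu>\<bar> < \<epsilon> \<longrightarrow>
        (\<exists>h h'. homeomorphism {0..<\<delta>} {0..<\<delta>'} h h' \<and> h 0 = 0 \<and>
           (\<forall>x\<in>{0..<\<delta>}. \<forall>y\<in>{0..<\<delta>}.
              scalar_reach (F \<nu>) {0..<\<delta>} x y \<longleftrightarrow> scalar_reach (G \<nu>) {0..<\<delta>'} (h x) (h y))))"

text \<open>
  Terms of degree greater than \<open>m\<close> are written \<open>r ^ (m + 1) * g \<nu> r\<close>, the form of a Taylor remainder;
  this includes polynomials in \<open>r\<close> with coefficients continuous in \<open>\<nu>\<close>.
\<close>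

definition C1_coefficient :: "(real \<Rightarrow> real \<Rightarrow> real) \<Rightarrow> bool" where
  "C1_coefficient g \<longleftrightarrow>
     (\<exists>g'. continuous_on UNIV (\<lambda>(\<nu>, r). g \<nu> r) \<and> continuous_on UNIV (\<lambda>(\<nu>, r). g' \<nu> r) \<and>
        (\<forall>\<nu> r. (g \<nu> has_real_derivative g' \<nu> r) (at r)))"

definition determined :: "nat \<Rightarrow> (real \<Rightarrow> real \<Rightarrow> real) \<Rightarrow> bool" where
  "determined m F \<longleftrightarrow>
     (\<forall>g. C1_coefficient g \<longrightarrow>
        locally_equivalent_families F (\<lambda>\<nu> r. F \<nu> r + r ^ (m + 1) * g \<nu> r))"

end

theory Submission
  imports Defs
begin

text \<open>
  On the leaf all radii are fixed multiples of \<open>\<rho> = \<rho>\<^sub>\<sigma>\<^sub>k\<close>, so up to its phases a motion is a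
  solution of the scalar equation \<open>\<rho>' = \<rho> (\<nu> + a \<rho>\<^sup>2)\<close> on \<open>[0, \<infinity>)\<close>. The closed leaf is the union of the
  compact shells \<open>\<rho> = r\<close>; the shell \<open>r = 0\<close> is the origin and the others are hypertori. Motions project
  to scalar solutions (\<open>radius_solution\<close>); conversely a scalar solution lifts to a motion from any point
  of its initial shell, the phases being obtained by integration (\<open>normal_form_lift\<close>). As every
  neighbourhood of a shell contains all shells of nearby radius (\<open>shell_nearby\<close>), all assertions about
  the leaf become assertions about the scalar equation.

  The orbits of a scalar \<open>C\<^sup>1\<close> field are determined by its signs, because no equilibrium is reached in
  finite time: \<open>x\<close> reaches \<open>y \<noteq> x\<close> exactly if the field points from \<open>x\<close> to \<open>y\<close> on the whole closed
  interval between them (\<open>scalar_reach_iff\<close>). Therefore an increasing bijection that preserves the sign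
  of the fields is an equivalence (\<open>scalar_reach_conjugate\<close>). The field \<open>\<rho> (\<nu> + a \<rho>\<^sup>2)\<close> has a positive
  zero exactly if \<open>\<nu> a < 0\<close>; it is then \<open>R = \<surd>(- \<nu> / a)\<close>, the field has the sign of \<open>a (\<rho> - R)\<close>, and
  \<open>R \<rightarrow> 0\<close> as \<open>\<nu> \<rightarrow> 0\<close>. This is the bifurcation of the torus from the origin. The other assertions
  have the following reasons.

  \<^item> Determinacy: for a small bounded interval and all small \<open>\<nu>\<close>, the bracket
    \<open>\<nu> + a r\<^sup>2 + r\<^sup>3 g(\<nu>, r)\<close> is still monotone in \<open>r\<close>, so it has a positive zero there exactly if
    \<open>\<nu> a < 0\<close>. A broken line that maps one zero to the other matches the signs.

  \<^item> Variety: parameters of the same sign are equivalent under a dilation of the leaf. At \<open>\<nu> = 0\<close>, of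
    any two points other than the origin one reaches the hypertorus of the other, whereas for \<open>\<nu> a < 0\<close>
    three points inside, on and outside the invariant torus are pairwise unrelated.

  \<^item> Stability: Lyapunov stability can be read off the reachability criterion. Attraction uses that
    \<open>1 / \<rho>\<^sup>2\<close> satisfies a linear equation, which gives explicit global solutions and their limits.

  \<^item> Repulsion: reversing time negates all coefficients, which turns the unstable torus into the
    stable one.
\<close>

section \<open>Scalar equations with a continuously differentiable field\<close>

definition C1_field :: "(real \<Rightarrow> real) \<Rightarrow> bool" where
  "C1_field f \<longleftrightarrow>
     (\<exists>f'. continuous_on UNIV f' \<and> (\<forall>r. (f has_real_derivative f' r) (at r)))"

lemma C1_field_continuous:
  assumes "C1_field f"
  shows "continuous_on S f"
proof -
  obtain f' where "\<And>r. (f has_real_derivative f' r) (at r)"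
    using assms unfolding C1_field_def by blast
  then have "\<And>r. isCont f r" by (rule DERIV_isCont)
  then show ?thesis by (simp add: continuous_at_imp_continuous_on)
qed

lemma C1_field_uminus:
  assumes "C1_field f"
  shows "C1_field (\<lambda>r. - f r)"
  using assms unfolding C1_field_def
  by (metis DERIV_minus continuous_on_minus)

lemma C1_field_reflect:
  assumes "C1_field f"
  shows "C1_field (\<lambda>r. - f (- r))"
proof -
  obtain f' where c: "continuous_on UNIV f'" and d: "\<And>r. (f has_real_derivative f' r) (at r)"
    using assms unfolding C1_field_def by blast
  have "((\<lambda>r. - f (- r)) has_real_derivative f' (- r)) (at r)" for r
    using DERIV_minus[OF DERIV_chain2[OF d[of "- r"] DERIV_minus[OF DERIV_ident]]] by simp
  moreover have "continuous_on UNIV (\<lambda>r. f' (- r))"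
    by (rule continuous_on_compose2[OF c]) (auto intro: continuous_intros)
  ultimately show ?thesis unfolding C1_field_def by blast
qed

lemma C1_field_Lipschitz_at:
  assumes "C1_field f"
  obtains L where "\<And>u. \<bar>u - p\<bar> \<le> M \<Longrightarrow> \<bar>f u - f p\<bar> \<le> L * \<bar>u - p\<bar>"
proof -
  obtain f' where c: "continuous_on UNIV f'" and d: "\<And>r. (f has_real_derivative f' r) (at r)"
    using assms unfolding C1_field_def by blast
  have "compact (f' ` cball p M)"
    by (intro compact_continuous_image continuous_on_subset[OF c]) auto
  then obtain L where L: "\<And>x. x \<in> cball p M \<Longrightarrow> \<bar>f' x\<bar> \<le> L"
    using compact_imp_bounded[of "f' ` cball p M"] unfolding bounded_iff by fastforce
  show ?thesis
  proof
    fix u :: real assume u: "\<bar>u - p\<bar> \<le> M"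
    then have "u \<in> cball p M" "p \<in> cball p M" by (auto simp: dist_real_def)
    then have "norm (f u - f p) \<le> L * norm (u - p)"
      by (intro field_differentiable_bound[where S = "cball p M" and f' = f'])
         (auto intro: L has_field_derivative_at_within[OF d])
    then show "\<bar>f u - f p\<bar> \<le> L * \<bar>u - p\<bar>" by simp
  qed
qed

text \<open>
  Equilibria cannot be left. This is a Gronwall argument: with a Lipschitz constant \<open>L\<close> of \<open>f\<close> at \<open>p\<close>,
  the function \<open>(u - p)\<^sup>2 exp (- 2 L t)\<close> is nonincreasing, nonnegative, and zero at time \<open>a\<close>.
\<close>

lemma forward_constant_at_equilibrium:
  assumes f: "C1_field f" and "f p = 0" and "u a = p" and ab: "a \<le> b"
    and u: "\<And>t. t \<in> {a..b} \<Longrightarrow> (u has_real_derivative f (u t)) (at t within {a..b})"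
  shows "u b = p"
proof -
  have "continuous_on {a..b} u"
    using u by (intro DERIV_continuous_on) auto
  then have "compact ((\<lambda>t. u t - p) ` {a..b})"
    by (intro compact_continuous_image continuous_intros) auto
  then obtain M where M: "\<And>t. t \<in> {a..b} \<Longrightarrow> \<bar>u t - p\<bar> \<le> M"
    using compact_imp_bounded by (fastforce simp: bounded_iff)
  obtain L where L: "\<And>v. \<bar>v - p\<bar> \<le> M \<Longrightarrow> \<bar>f v - f p\<bar> \<le> L * \<bar>v - p\<bar>"
    using C1_field_Lipschitz_at[OF f] by blast
  define w where "w t = (u t - p)\<^sup>2 * exp (- 2 * L * t)" for t
  have dw: "(w has_real_derivative
      2 * ((u t - p) * f (u t) - L * (u t - p)\<^sup>2) * exp (- 2 * L * t)) (at t within {a..b})"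
    if "t \<in> {a..b}" for t
    unfolding w_def
    by (rule derivative_eq_intros u[OF that] refl)+ (simp add: algebra_simps power2_eq_square)
  have "w b \<le> w a"
  proof (rule DERIV_nonpos_imp_decreasing_open[OF ab])
    fix t assume t: "a < t" "t < b"
    have "\<bar>f (u t)\<bar> \<le> L * \<bar>u t - p\<bar>"
      using L[OF M[of t]] t \<open>f p = 0\<close> by auto
    then have "\<bar>u t - p\<bar> * \<bar>f (u t)\<bar> \<le> \<bar>u t - p\<bar> * (L * \<bar>u t - p\<bar>)"
      by (intro mult_left_mono) auto
    then have "(u t - p) * f (u t) \<le> L * (u t - p)\<^sup>2"
      by (simp add: abs_mult[symmetric] power2_eq_square algebra_simps)
    moreover have "(w has_real_derivative
      2 * ((u t - p) * f (u t) - L * (u t - p)\<^sup>2) * exp (- 2 * L * t)) (at t)"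
      using dw[of t] t at_within_Icc_at[of a t b] by auto
    ultimately show "\<exists>y. (w has_real_derivative y) (at t) \<and> y \<le> 0"
      by (auto intro!: exI mult_nonpos_nonneg)
  next
    show "continuous_on {a..b} w"
      using dw by (intro DERIV_continuous_on) auto
  qed
  then have "(u b - p)\<^sup>2 * exp (- 2 * L * b) \<le> 0"
    by (simp add: w_def \<open>u a = p\<close>)
  then show ?thesis
    by (simp add: mult_le_0_iff)
qed

lemma DERIV_reflect_within:
  fixes f :: "real \<Rightarrow> real"
  assumes "(f has_real_derivative D) (at (- t) within uminus ` I)"
  shows "((\<lambda>t. f (- t)) has_real_derivative - D) (at t within I)"
  using DERIV_image_chain[of f D uminus t I "- 1"] assms DERIV_minus[OF DERIV_ident]
  by (auto simp: o_def)

lemma is_interval_Icc_subset: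
  fixes X :: "real set"
  assumes "is_interval X" "a \<in> X" "b \<in> X"
  shows "{a..b} \<subseteq> X"
  using assms unfolding is_interval_1 by (meson atLeastAtMost_iff subsetI)

text \<open>
  In backward time \<open>forward_constant_at_equilibrium\<close> applies to \<open>u (- t)\<close>, a solution for the field \<open>- f\<close>. Hence a
  solution that is not constant never meets an equilibrium.
\<close>

lemma constant_at_equilibrium:
  assumes f: "C1_field f" and "f p = 0" and "is_interval I"
    and u: "\<And>t. t \<in> I \<Longrightarrow> (u has_real_derivative f (u t)) (at t within I)"
    and "t0 \<in> I" "u t0 = p" "t \<in> I"
  shows "u t = p"
proof (cases "t0 \<le> t")
  case True
  then have sub: "{t0..t} \<subseteq> I"
    using is_interval_Icc_subset \<open>is_interval I\<close> \<open>t0 \<in> I\<close> \<open>t \<in> I\<close> by blast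
  show ?thesis
    by (rule forward_constant_at_equilibrium[where u = u, OF f \<open>f p = 0\<close> \<open>u t0 = p\<close> True])
       (meson sub DERIV_subset u subsetD)
next
  case False
  then have sub: "{t..t0} \<subseteq> I"
    using is_interval_Icc_subset \<open>is_interval I\<close> \<open>t0 \<in> I\<close> \<open>t \<in> I\<close> by blast
  define v where "v s = u (- s)" for s
  have "v (- t) = p"
  proof (rule forward_constant_at_equilibrium[OF C1_field_uminus[OF f], of p v "- t0"])
    fix s assume "s \<in> {- t0..- t}"
    then have "(u has_real_derivative f (u (- s))) (at (- s) within {t..t0})"
      using sub by (intro DERIV_subset[OF u]) auto
    then show "(v has_real_derivative - f (v s)) (at s within {- t0..- t})"
      unfolding v_def by (intro DERIV_reflect_within) simp
  qed (use assms False in \<open>auto simp: v_def\<close>)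
  then show ?thesis by (simp add: v_def)
qed

text \<open>
  Where \<open>f\<close> is positive, the travel time is an antiderivative \<open>A\<close> of \<open>1 / f\<close>, and the solution is its
  inverse function. To have the inverse differentiable at both end points, \<open>f\<close> is first extended beyond
  \<open>[x, y]\<close> by its boundary values.
\<close>

lemma scalar_reach_up:
  assumes f: "continuous_on {x..y} f" and xy: "x < y" and pos: "\<And>z. z \<in> {x..y} \<Longrightarrow> 0 < f z"
    and X: "{x..y} \<subseteq> X"
  shows "scalar_reach f X x y"
proof -
  define g where "g s = f (max x (min y s))" for s
  have g_pos: "0 < g s" for s
    unfolding g_def using xy by (intro pos) auto
  have g_cont: "continuous_on S g" for S
    unfolding g_def using xy
    by (intro continuous_on_compose2[OF f, of S "\<lambda>s. max x (min y s)"] continuous_intros) auto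
  define A where "A s = integral {x - 1..s} (\<lambda>r. 1 / g r)" for s
  have dA': "(A has_real_derivative 1 / g s) (at s within {x - 1..y + 1})" if "s \<in> {x - 1..y + 1}" for s
    unfolding A_def
    by (rule integral_has_real_derivative[OF _ that])
       (use g_pos in \<open>auto intro!: continuous_on_divide g_cont simp: less_imp_neq[THEN not_sym]\<close>)
  have A_cont: "continuous_on {x - 1..y + 1} A"
    by (rule DERIV_continuous_on[OF dA'])
  have dA: "(A has_real_derivative 1 / g s) (at s)" if "x - 1 < s" "s < y + 1" for s
    using dA'[of s] that by (simp add: at_within_Icc_at)
  have A_mono: "A s < A t" if "x - 1 \<le> s" "s < t" "t \<le> y + 1" for s t
  proof (rule DERIV_pos_imp_increasing_open[OF \<open>s < t\<close>])
    show "\<exists>d. (A has_real_derivative d) (at r) \<and> 0 < d" if "s < r" "r < t" for r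
      using dA[of r] g_pos[of r] that \<open>x - 1 \<le> s\<close> \<open>t \<le> y + 1\<close> by (auto intro!: exI)
    show "continuous_on {s..t} A"
      by (rule continuous_on_subset[OF A_cont]) (use that in auto)
  qed
  have inj: "inj_on A {x - 1..y + 1}"
    by (rule linorder_inj_onI) (use A_mono in \<open>force+\<close>)
  define v where "v = the_inv_into {x - 1..y + 1} A"
  have vA: "v (A s) = s" if "s \<in> {x - 1..y + 1}" for s
    unfolding v_def by (rule the_inv_into_f_f[OF inj that])
  have onto: "\<exists>s\<in>{x - 1..y + 1}. A s = t" if "t \<in> {A (x - 1)..A (y + 1)}" for t
    using IVT'[of A "x - 1" t "y + 1"] that xy A_cont by auto
  have img: "A ` {x - 1..y + 1} = {A (x - 1)..A (y + 1)}"
  proof (intro equalityI subsetI)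
    fix t assume "t \<in> A ` {x - 1..y + 1}"
    then obtain s where "s \<in> {x - 1..y + 1}" "t = A s" by blast
    moreover have "A r \<le> A r'" if "x - 1 \<le> r" "r \<le> r'" "r' \<le> y + 1" for r r'
      using A_mono[of r r'] that by (cases "r = r'") auto
    ultimately show "t \<in> {A (x - 1)..A (y + 1)}"
      by auto
  qed (use onto in blast)
  have v_cont: "continuous_on {A (x - 1)..A (y + 1)} v"
    using continuous_on_inv[OF A_cont, of v] vA img by auto
  have dv: "(v has_real_derivative g (v t)) (at t)" if t: "A (x - 1) < t" "t < A (y + 1)" for t
  proof -
    obtain s where s: "s \<in> {x - 1..y + 1}" "A s = t" using onto[of t] t by auto
    have s': "x - 1 < s" "s < y + 1" using s t by (metis atLeastAtMost_iff order.order_iff_strict order.irrefl)+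
    have "(v has_real_derivative inverse (1 / g (v t))) (at t)"
    proof (rule DERIV_inverse_function[where f = A and g = v and x = t])
      have "v t = s" using vA s by blast
      then show "(A has_real_derivative 1 / g (v t)) (at (v t))"
        using dA s' by simp
      show "1 / g (v t) \<noteq> 0" using g_pos[of "v t"] by simp
      show "A (x - 1) < t" "t < A (y + 1)" by (fact t)+
      show "A (v r) = r" if "A (x - 1) < r" "r < A (y + 1)" for r
        using onto[of r] vA that by (metis atLeastAtMost_iff less_imp_le)
      show "isCont v t"
        by (rule continuous_on_interior[OF v_cont]) (use t in simp)
    qed
    then show ?thesis by simp
  qed
  define T where "T = A y - A x"
  define u where "u t = v (t + A x)" for t
  have T: "0 < T" using A_mono[of x y] xy by (simp add: T_def)
  have u_in: "u t \<in> {x..y}" if "t \<in> {0..T}" for t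
  proof -
    have "continuous_on {x..y} A"
      by (rule continuous_on_subset[OF A_cont]) auto
    then have "\<exists>s\<ge>x. s \<le> y \<and> A s = t + A x"
      using that xy by (intro IVT') (auto simp: T_def)
    then obtain s where s: "s \<in> {x..y}" "A s = t + A x" by auto
    then have "u t = s" unfolding u_def using vA[of s] by simp
    then show ?thesis using s by blast
  qed
  have "u 0 = x" "u T = y"
    using vA xy by (auto simp: u_def T_def)
  moreover have "(u has_real_derivative f (u t)) (at t within {0..T})" if t: "t \<in> {0..T}" for t
  proof -
    have "A (x - 1) < t + A x" "t + A x < A (y + 1)"
      using t A_mono[of "x - 1" x] A_mono[of y "y + 1"] xy by (auto simp: T_def)
    then have "(u has_real_derivative g (u t)) (at t)"
      unfolding u_def using DERIV_shift[of v "g (v (t + A x))" t "A x"] dv by auto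
    moreover have "g (u t) = f (u t)"
      using u_in[OF t] by (auto simp: g_def)
    ultimately show ?thesis by (simp add: has_field_derivative_at_within)
  qed
  ultimately show ?thesis
    unfolding scalar_reach_def using T u_in X by (intro exI[of _ T] exI[of _ u] conjI) auto
qed

lemma scalar_reach_reflect:
  assumes "scalar_reach (\<lambda>r. - f (- r)) (uminus ` X) (- x) (- y)"
  shows "scalar_reach f X x y"
proof -
  obtain T u where T: "T \<ge> 0" "u 0 = - x" "u T = - y"
    and u: "\<And>t. t \<in> {0..T} \<Longrightarrow> u t \<in> uminus ` X"
    "\<And>t. t \<in> {0..T} \<Longrightarrow> (u has_real_derivative - f (- u t)) (at t within {0..T})"
    using assms unfolding scalar_reach_def by blast
  show ?thesis
    unfolding scalar_reach_def
    by (rule exI[of _ T], intro conjI T exI[of _ "\<lambda>t. - u t"])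
       (use T u DERIV_minus[OF u(2)] in \<open>force+\<close>)
qed

text \<open>
  Along a solution from \<open>x\<close> to \<open>y \<noteq> x\<close> the field cannot vanish, so it has a constant sign, which the
  mean value theorem identifies as the sign of \<open>y - x\<close>; by the intermediate value theorem the solution
  visits every point between \<open>x\<close> and \<open>y\<close>. The converse is the integration of the equation, reflected
  at \<open>0\<close> for a negative field.
\<close>

lemma scalar_reach_iff:
  assumes f: "C1_field f" and X: "is_interval X" and x: "x \<in> X" and y: "y \<in> X"
  shows "scalar_reach f X x y \<longleftrightarrow>
    x = y \<or> (x < y \<and> (\<forall>z\<in>{x..y}. 0 < f z)) \<or> (y < x \<and> (\<forall>z\<in>{y..x}. f z < 0))"
    (is "_ \<longleftrightarrow> ?R")
proof
  assume "scalar_reach f X x y"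
  then obtain T u where T: "T \<ge> 0" "u 0 = x" "u T = y"
    and u: "\<And>t. t \<in> {0..T} \<Longrightarrow> (u has_real_derivative f (u t)) (at t within {0..T})"
    unfolding scalar_reach_def by blast
  show ?R
  proof (cases "x = y")
    case False
    then have "0 < T" using T by (cases "T = 0") auto
    have u_cont: "continuous_on {0..T} u"
      using u by (intro DERIV_continuous_on) auto
    \<comment> \<open>A zero of the field on the way would make the solution constant.\<close>
    have nz: "f (u t) \<noteq> 0" if "t \<in> {0..T}" for t
    proof
      assume "f (u t) = 0"
      then have "u s = u t" if "s \<in> {0..T}" for s
        using constant_at_equilibrium[where u = u and t = s, OF f _ _ u, of "u t" t] \<open>t \<in> {0..T}\<close> that
        by (auto simp: is_interval_cc)
      from this[of 0] this[of T] show False using T False by auto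
    qed
    have fu_cont: "continuous_on {0..T} (\<lambda>t. f (u t))"
      by (rule continuous_on_compose2[OF C1_field_continuous[OF f, of UNIV] u_cont]) auto
    have "connected (u ` {0..T})"
      by (intro connected_continuous_image u_cont) auto
    moreover have "x \<in> u ` {0..T}" "y \<in> u ` {0..T}"
      using T by (auto intro: image_eqI[where x = 0] image_eqI[where x = T])
    ultimately have between: "{x..y} \<subseteq> u ` {0..T}" "{y..x} \<subseteq> u ` {0..T}"
      by (simp_all add: connected_contains_Icc)
    have conn: "connected ((\<lambda>t. f (u t)) ` {0..T})"
      by (intro connected_continuous_image fu_cont) auto
    have sign: "0 < f (u s) \<longleftrightarrow> 0 < f (u t)" if "s \<in> {0..T}" "t \<in> {0..T}" for s t
    proof (rule ccontr)
      assume "\<not> ?thesis"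
      then have "0 \<in> {f (u s)..f (u t)} \<or> 0 \<in> {f (u t)..f (u s)}" by (simp add: not_less) linarith
      then have "0 \<in> (\<lambda>t. f (u t)) ` {0..T}"
        using connected_contains_Icc[OF conn] that by blast
      then show False using nz by force
    qed
    obtain \<xi> where \<xi>: "0 < \<xi>" "\<xi> < T" "u T - u 0 = T * f (u \<xi>)"
    proof -
      have "\<exists>z\<in>{0<..<T}. u T - u 0 = f (u z) * (T - 0)"
        by (rule mvt_simple[OF \<open>0 < T\<close>]) (use u in \<open>simp add: has_field_derivative_def\<close>)
      then show ?thesis using that by (auto simp: mult.commute)
    qed
    show ?thesis
    proof (cases "x < y")
      case True
      then have "0 < f (u \<xi>)" using \<xi> T \<open>0 < T\<close>
        by (metis diff_gt_0_iff_gt zero_less_mult_pos)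
      then have "0 < f (u t)" if "t \<in> {0..T}" for t
        using sign[of t \<xi>] \<xi> that by auto
      then have "0 < f z" if "z \<in> {x..y}" for z
        using between(1) that by blast
      then show ?thesis using True by blast
    next
      case xy: False
      then have "T * f (u \<xi>) < 0" using \<xi> T False by auto
      then have "\<not> 0 < f (u \<xi>)" using \<open>0 < T\<close> by (simp add: mult_less_0_iff)
      then have "f (u t) < 0" if "t \<in> {0..T}" for t
        using sign[of t \<xi>] nz[of t] \<xi> that by auto
      then have "f z < 0" if "z \<in> {y..x}" for z
        using between(2) that by blast
      then show ?thesis using xy False by auto
    qed
  qed auto
next
  assume ?R
  then consider "x = y" | "x < y" "\<forall>z\<in>{x..y}. 0 < f z" | "y < x" "\<forall>z\<in>{y..x}. f z < 0" by blast
  then show "scalar_reach f X x y"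
  proof cases
    case 1
    \<comment> \<open>The constant curve on the degenerate time interval \<open>{0..0}\<close>, where derivatives are unconstrained.\<close>
    have "at 0 within {0::real} = bot" by (simp add: at_within_eq_bot_iff)
    with 1 show ?thesis
      unfolding scalar_reach_def using x
      by (intro exI[of _ 0] conjI exI[of _ "\<lambda>_. x"])
         (auto simp: has_field_derivative_iff)
  next
    case 2
    then show ?thesis
      using is_interval_Icc_subset[OF X x y]
      by (intro scalar_reach_up C1_field_continuous[OF f]) blast+
  next
    case 3
    have "scalar_reach (\<lambda>r. - f (- r)) (uminus ` X) (- x) (- y)"
    proof (rule scalar_reach_up)
      show "continuous_on {- x..- y} (\<lambda>r. - f (- r))"
        by (rule C1_field_continuous[OF C1_field_reflect[OF f]])
      show "{- x..- y} \<subseteq> uminus ` X"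
      proof
        fix z assume "z \<in> {- x..- y}"
        then have "- z \<in> X" using is_interval_Icc_subset[OF X y x] by auto
        then show "z \<in> uminus ` X" by (metis add.inverse_inverse imageI)
      qed
    qed (use 3 in auto)
    then show ?thesis by (rule scalar_reach_reflect)
  qed
qed

lemma equilibrium_not_crossed:
  assumes f: "C1_field f" and X: "is_interval X" "x \<in> X" "y \<in> X" and reach: "scalar_reach f X x y"
    and "f p = 0" "min x y \<le> p" "p \<le> max x y"
  shows "x = y"
proof (rule ccontr)
  assume "x \<noteq> y"
  then consider "x < y" "\<forall>z\<in>{x..y}. 0 < f z" | "y < x" "\<forall>z\<in>{y..x}. f z < 0"
    using reach unfolding scalar_reach_iff[OF f X] by blast
  then show False
  proof cases
    case 1
    then have "0 < f p" using assms(7,8) by simp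
    then show False using \<open>f p = 0\<close> by simp
  next
    case 2
    then have "f p < 0" using assms(7,8) by simp
    then show False using \<open>f p = 0\<close> by simp
  qed
qed

text \<open>
  By \<open>scalar_reach_iff\<close>, reachability depends only on the order of the points and on the signs of the
  field, both of which \<open>h\<close> preserves.
\<close>

lemma scalar_reach_conjugate:
  assumes f: "C1_field f" and g: "C1_field g" and X: "is_interval X" and Y: "is_interval Y"
    and h: "bij_betw h X Y" "strict_mono_on X h"
    and sgn: "\<And>x. x \<in> X \<Longrightarrow> sgn (f x) = sgn (g (h x))"
    and xy: "x \<in> X" "y \<in> X"
  shows "scalar_reach f X x y \<longleftrightarrow> scalar_reach g Y (h x) (h y)"
proof -
  have hY: "\<And>x. x \<in> X \<Longrightarrow> h x \<in> Y" using h by (auto simp: bij_betw_def)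
  have less: "h a < h b \<longleftrightarrow> a < b" if "a \<in> X" "b \<in> X" for a b
    using strict_mono_on_less[OF h(2)] that by blast
  have le: "h a \<le> h b \<longleftrightarrow> a \<le> b" if "a \<in> X" "b \<in> X" for a b
    using less[of b a] that by (metis not_less)
  note sub = is_interval_Icc_subset[OF X]
  have img: "h ` {a..b} = {h a..h b}" if ab: "a \<in> X" "b \<in> X" for a b
  proof (intro equalityI subsetI)
    fix w assume "w \<in> h ` {a..b}"
    then show "w \<in> {h a..h b}" using le ab sub[OF ab] by auto
  next
    fix w assume w: "w \<in> {h a..h b}"
    then have "w \<in> Y" using is_interval_Icc_subset[OF Y hY[OF ab(1)] hY[OF ab(2)]] by blast
    then obtain z where z: "z \<in> X" "w = h z" using h by (auto simp: bij_betw_def)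
    then have "z \<in> {a..b}" using w le ab by simp
    then show "w \<in> h ` {a..b}" using z by blast
  qed
  have eq: "h x = h y \<longleftrightarrow> x = y" using h xy by (auto simp: bij_betw_def inj_on_def)
  have sgns: "0 < f x \<longleftrightarrow> 0 < g (h x)" "f x < 0 \<longleftrightarrow> g (h x) < 0" if "x \<in> X" for x
    using sgn[OF that] by (metis sgn_greater, metis sgn_less)
  have pos: "(\<forall>z\<in>{a..b}. 0 < f z) \<longleftrightarrow> (\<forall>w\<in>{h a..h b}. 0 < g w)"
    and neg: "(\<forall>z\<in>{a..b}. f z < 0) \<longleftrightarrow> (\<forall>w\<in>{h a..h b}. g w < 0)"
    if "a \<in> X" "b \<in> X" for a b
    using sub[OF that] sgns unfolding img[OF that, symmetric] by blast+
  show ?thesis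
    unfolding scalar_reach_iff[OF f X xy] scalar_reach_iff[OF g Y hY[OF xy(1)] hY[OF xy(2)]]
    using eq less xy pos neg by metis
qed

section \<open>Three-determinacy of the pitchfork\<close>

lemma sign_change_of_increasing:
  fixes \<psi> :: "real \<Rightarrow> real"
  assumes "0 < \<delta>" and cont: "continuous_on {0..\<delta>} \<psi>"
    and mono: "\<And>x y. 0 \<le> x \<Longrightarrow> x < y \<Longrightarrow> y \<le> \<delta> \<Longrightarrow> \<psi> x < \<psi> y" and "0 < \<psi> \<delta>"
  obtains r where "0 \<le> r" "r < \<delta>" "r = 0 \<longleftrightarrow> 0 \<le> \<psi> 0"
    "\<And>x. 0 < x \<Longrightarrow> x < \<delta> \<Longrightarrow> sgn (\<psi> x) = sgn (x - r)"
proof (cases "0 \<le> \<psi> 0")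
  case True
  then show ?thesis
    using that[of 0] mono[of 0] \<open>0 < \<delta>\<close> by force
next
  case False
  then obtain r where r: "0 \<le> r" "r \<le> \<delta>" "\<psi> r = 0"
    using IVT'[of \<psi> 0 0 \<delta>] cont \<open>0 < \<delta>\<close> \<open>0 < \<psi> \<delta>\<close> by auto
  then have r': "r \<noteq> 0" "r < \<delta>"
    using False \<open>0 < \<psi> \<delta>\<close> by (auto simp: order.order_iff_strict)
  have "sgn (\<psi> x) = sgn (x - r)" if "0 < x" "x < \<delta>" for x
    using mono[of x r] mono[of r x] that r r' by (cases x r rule: linorder_cases) auto
  then show ?thesis
    using that[of r] r r' False by auto
qed

text \<open>
  The bracket \<open>\<nu> + r\<^sup>2 (a + r g r)\<close> has the derivative \<open>r (2 a + 3 r g r + r\<^sup>2 g' r)\<close>. On \<open>[0, \<delta>]\<close> the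
  bound \<open>4 \<delta> M \<le> \<bar>a\<bar>\<close> keeps the terms with \<open>g\<close> below \<open>2 \<bar>a\<bar>\<close>, so that the bracket multiplied by \<open>sgn a\<close>
  is increasing. The bound on \<open>\<nu>\<close> makes it positive at \<open>\<delta>\<close>. So whether it vanishes inside depends only
  on the sign of its value \<open>sgn a * \<nu>\<close> at \<open>0\<close>, in the same way for all remainders \<open>g\<close>; the convention
  \<open>r = 0\<close> when there is no positive zero treats both cases uniformly.
\<close>

lemma sgn_amplitude_with_remainder:
  fixes a \<nu> \<delta> M :: real and g g' :: "real \<Rightarrow> real"
  assumes a: "a \<noteq> 0" and \<delta>: "0 < \<delta>" "\<delta> \<le> 1" "4 * \<delta> * M \<le> \<bar>a\<bar>"
    and g: "\<And>r. (g has_real_derivative g' r) (at r)"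
    and M: "\<And>r. r \<in> {0..\<delta>} \<Longrightarrow> \<bar>g r\<bar> \<le> M" "\<And>r. r \<in> {0..\<delta>} \<Longrightarrow> \<bar>g' r\<bar> \<le> M"
    and \<nu>: "\<bar>\<nu>\<bar> < \<delta>\<^sup>2 * \<bar>a\<bar> / 2"
  obtains r where "0 \<le> r" "r < \<delta>" "r = 0 \<longleftrightarrow> 0 \<le> sgn a * \<nu>"
    "\<And>x. x \<in> {0..<\<delta>} \<Longrightarrow>
      sgn (x * (\<nu> + a * x\<^sup>2) + x ^ 4 * g x) = sgn a * (sgn x * sgn (x - r))"
proof -
  define \<psi> where "\<psi> r = sgn a * (\<nu> + r\<^sup>2 * (a + r * g r))" for r
  have d\<psi>: "(\<psi> has_real_derivative r * (2 * \<bar>a\<bar> + sgn a * (3 * (r * g r) + r\<^sup>2 * g' r))) (at r)" for r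
    unfolding \<psi>_def
    by (rule derivative_eq_intros g refl)+
       (simp add: algebra_simps power2_eq_square abs_sgn)
  have M0: "0 \<le> M" using M(1)[of 0] \<delta> by auto
  have "2 * \<bar>a\<bar> + sgn a * (3 * (r * g r) + r\<^sup>2 * g' r) > 0" if r: "0 < r" "r \<le> \<delta>" for r
  proof -
    have "\<bar>r * g r\<bar> \<le> \<delta> * M"
      using M(1)[of r] r by (auto simp: abs_mult intro!: mult_mono)
    moreover have "\<bar>r\<^sup>2 * g' r\<bar> \<le> \<delta> * M"
    proof -
      have "r\<^sup>2 \<le> \<delta> * 1" unfolding power2_eq_square using r \<delta> by (intro mult_mono) auto
      then show ?thesis using M(2)[of r] r M0 \<delta> by (auto simp: abs_mult intro!: mult_mono)
    qed
    moreover have "\<bar>sgn a * (3 * (r * g r) + r\<^sup>2 * g' r)\<bar> \<le> 3 * \<bar>r * g r\<bar> + \<bar>r\<^sup>2 * g' r\<bar>"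
    proof -
      have "\<bar>sgn a * y\<bar> = \<bar>y\<bar>" for y using a by (simp add: abs_mult abs_sgn_eq)
      from this[of "3 * (r * g r) + r\<^sup>2 * g' r"] show ?thesis by linarith
    qed
    ultimately have "\<bar>sgn a * (3 * (r * g r) + r\<^sup>2 * g' r)\<bar> \<le> 4 * \<delta> * M" by linarith
    then show ?thesis using \<delta>(3) a by linarith
  qed
  then have mono: "\<psi> x < \<psi> y" if "0 \<le> x" "x < y" "y \<le> \<delta>" for x y
    using that
    by (intro DERIV_pos_imp_increasing_open[of x y \<psi>] exI conjI d\<psi> DERIV_continuous_on[where f = \<psi>]
          mult_pos_pos) (auto intro: has_field_derivative_at_within d\<psi>)
  have cont: "continuous_on {0..\<delta>} \<psi>"
    by (rule DERIV_continuous_on[OF has_field_derivative_at_within[OF d\<psi>]])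
  have pos: "0 < \<psi> \<delta>"
  proof -
    have "\<bar>\<delta> * g \<delta>\<bar> \<le> \<delta> * M" using M(1)[of \<delta>] \<delta> by (auto simp: abs_mult)
    then have "\<bar>\<delta> * g \<delta>\<bar> \<le> \<bar>a\<bar> / 2" using \<delta>(3) by linarith
    then have "sgn a * (a + \<delta> * g \<delta>) \<ge> \<bar>a\<bar> / 2" using a by (auto simp: sgn_if abs_if split: if_splits)
    then have "\<delta>\<^sup>2 * (sgn a * (a + \<delta> * g \<delta>)) \<ge> \<delta>\<^sup>2 * (\<bar>a\<bar> / 2)" by (intro mult_left_mono) auto
    moreover have "sgn a * \<nu> \<ge> - \<bar>\<nu>\<bar>" using a by (auto simp: sgn_if)
    ultimately show ?thesis using \<nu> by (simp add: \<psi>_def algebra_simps)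
  qed
  obtain r where r: "0 \<le> r" "r < \<delta>" "r = 0 \<longleftrightarrow> 0 \<le> \<psi> 0"
    "\<And>x. 0 < x \<Longrightarrow> x < \<delta> \<Longrightarrow> sgn (\<psi> x) = sgn (x - r)"
    by (rule sign_change_of_increasing[OF \<delta>(1) cont _ pos]) (use mono in \<open>blast+\<close>)
  have "sgn (x * (\<nu> + a * x\<^sup>2) + x ^ 4 * g x) = sgn a * (sgn x * sgn (x - r))"
    if "x \<in> {0..<\<delta>}" for x
  proof (cases "x = 0")
    case False
    have "x * (\<nu> + a * x\<^sup>2) + x ^ 4 * g x = sgn a * (x * \<psi> x)"
      using a by (simp add: \<psi>_def algebra_simps sgn_if power2_eq_square power4_eq_xxxx)
    then show ?thesis using r(4)[of x] that False a by (simp add: sgn_mult)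
  qed simp
  then show ?thesis using that[of r] r by (auto simp: \<psi>_def)
qed

text \<open>
  The piecewise linear map with \<open>0 \<mapsto> 0\<close>, \<open>p \<mapsto> q\<close>, \<open>\<delta> \<mapsto> \<delta>\<close>. With \<open>min\<close> and \<open>max\<close> instead of a case
  distinction it is visibly continuous, and for \<open>p = q = 0\<close> it is the identity on \<open>[0, \<delta>]\<close>.
\<close>

definition broken_line :: "real \<Rightarrow> real \<Rightarrow> real \<Rightarrow> real \<Rightarrow> real" where
  "broken_line \<delta> p q x = min x p * (q / p) + max 0 (x - p) * ((\<delta> - q) / (\<delta> - p))"

lemma broken_line_strict_mono:
  assumes "0 \<le> p" "p < \<delta>" "0 \<le> q" "q < \<delta>" "p = 0 \<longleftrightarrow> q = 0" "x < y"
  shows "broken_line \<delta> p q x < broken_line \<delta> p q y \<or> (p = 0 \<and> x < 0)"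
proof -
  consider "y \<le> p" "p \<noteq> 0" | "x \<ge> p" | "x < p" "p < y" "p \<noteq> 0" | "p = 0" "x < 0"
    using \<open>x < y\<close> by force
  then show ?thesis
  proof cases
    case 1
    have "x * (q / p) < y * (q / p)" using 1 assms by (intro mult_strict_right_mono) auto
    then show ?thesis using 1 assms by (simp add: broken_line_def)
  next
    case 2
    have "(x - p) * ((\<delta> - q) / (\<delta> - p)) < (y - p) * ((\<delta> - q) / (\<delta> - p))"
      using 2 assms by (intro mult_strict_right_mono) auto
    then show ?thesis using 2 assms by (simp add: broken_line_def min_absorb2)
  next
    case 3
    have "x * (q / p) < p * (q / p)" using 3 assms by (intro mult_strict_right_mono) auto
    moreover have "0 < (y - p) * ((\<delta> - q) / (\<delta> - p))" using 3 assms by simp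
    ultimately have "x * (q / p) < p * (q / p) + (y - p) * ((\<delta> - q) / (\<delta> - p))" by linarith
    then show ?thesis using 3 assms by (simp add: broken_line_def)
  qed auto
qed

lemma broken_line_inverse:
  assumes "0 \<le> p" "p < \<delta>" "0 \<le> q" "q < \<delta>" "p = 0 \<longleftrightarrow> q = 0" and x: "x \<in> {0..<\<delta>}"
  shows "broken_line \<delta> q p (broken_line \<delta> p q x) = x"
proof (cases "x \<le> p")
  case True
  then have "broken_line \<delta> p q x = x * (q / p)" by (simp add: broken_line_def)
  moreover have "x * (q / p) \<le> p * (q / p)" using True assms by (intro mult_right_mono) auto
  ultimately show ?thesis using True assms by (cases "p = 0") (auto simp: broken_line_def)
next
  case False
  have "broken_line \<delta> p q x = q + (x - p) * ((\<delta> - q) / (\<delta> - p))"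
    using False assms by (auto simp: broken_line_def)
  moreover have "0 < (x - p) * ((\<delta> - q) / (\<delta> - p))" using False assms by simp
  ultimately have "broken_line \<delta> q p (broken_line \<delta> p q x) =
      p + (x - p) * ((\<delta> - q) / (\<delta> - p)) * ((\<delta> - p) / (\<delta> - q))"
    using assms by (auto simp: broken_line_def)
  then show ?thesis using assms by simp
qed

lemma broken_line_range:
  assumes "0 \<le> p" "p < \<delta>" "0 \<le> q" "q < \<delta>" "p = 0 \<longleftrightarrow> q = 0" and x: "x \<in> {0..<\<delta>}"
  shows "broken_line \<delta> p q x \<in> {0..<\<delta>}"
proof -
  have "broken_line \<delta> p q 0 = 0" "broken_line \<delta> p q \<delta> = \<delta>"
    using assms by (auto simp: broken_line_def)
  moreover have "broken_line \<delta> p q 0 \<le> broken_line \<delta> p q x"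
    using broken_line_strict_mono[of p \<delta> q 0 x] assms by (cases "x = 0") auto
  moreover have "broken_line \<delta> p q x < broken_line \<delta> p q \<delta>"
    using broken_line_strict_mono[of p \<delta> q x \<delta>] assms by auto
  ultimately show ?thesis by simp
qed

lemma broken_line_homeomorphism:
  assumes "0 \<le> p" "p < \<delta>" "0 \<le> q" "q < \<delta>" "p = 0 \<longleftrightarrow> q = 0"
  shows "homeomorphism {0..<\<delta>} {0..<\<delta>} (broken_line \<delta> p q) (broken_line \<delta> q p)"
proof (rule homeomorphismI)
  show "continuous_on {0..<\<delta>} (broken_line \<delta> p q)" "continuous_on {0..<\<delta>} (broken_line \<delta> q p)"
    unfolding broken_line_def by (intro continuous_intros)+
qed (use broken_line_range[OF assms] broken_line_range[of q \<delta> p] broken_line_inverse[OF assms]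
    broken_line_inverse[of q \<delta> p] assms in auto)

lemma C1_field_pitchfork: "C1_field (\<lambda>r. r * (\<nu> + a * r\<^sup>2))"
  unfolding C1_field_def
  by (intro exI[of _ "\<lambda>r. \<nu> + 3 * a * r\<^sup>2"] conjI allI continuous_intros)
     (auto intro!: derivative_eq_intros simp: algebra_simps power2_eq_square)

text \<open>
  Both the cubic field and its perturbation have the signs \<open>sgn a * sgn x * sgn (x - r)\<close>, with \<open>r = p\<close>
  and \<open>r = q\<close> respectively, where \<open>p\<close> and \<open>q\<close> are zero for the same parameters. The broken line that
  maps \<open>p\<close> to \<open>q\<close> preserves these signs.
\<close>

lemma pitchfork_three_determined:
  assumes a: "a \<noteq> 0"
  shows "determined 3 (\<lambda>\<nu> r. r * (\<nu> + a * r\<^sup>2))"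
  unfolding determined_def
proof (intro allI impI)
  fix g assume "C1_coefficient g"
  then obtain g' where gc: "continuous_on UNIV (\<lambda>(\<nu>, r). g \<nu> r)"
    and g'c: "continuous_on UNIV (\<lambda>(\<nu>, r). g' \<nu> r)"
    and dg: "\<And>\<nu> r. (g \<nu> has_real_derivative g' \<nu> r) (at r)"
    unfolding C1_coefficient_def by blast
  define K where "K = {- 1..1::real} \<times> {0..1::real}"
  have K: "compact K" unfolding K_def by (intro compact_Times) auto
  have "bounded ((\<lambda>(\<nu>, r). g \<nu> r) ` K)" "bounded ((\<lambda>(\<nu>, r). g' \<nu> r) ` K)"
    by (intro compact_imp_bounded compact_continuous_image continuous_on_subset[OF gc]
          continuous_on_subset[OF g'c] K; simp)+
  then obtain M1 M2 where M1: "\<forall>p\<in>K. \<bar>g (fst p) (snd p)\<bar> \<le> M1"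
    and M2: "\<forall>p\<in>K. \<bar>g' (fst p) (snd p)\<bar> \<le> M2"
    unfolding bounded_iff by (force simp: case_prod_unfold)
  define M where "M = max M1 M2"
  have M: "\<bar>g \<nu> r\<bar> \<le> M" "\<bar>g' \<nu> r\<bar> \<le> M" if "\<bar>\<nu>\<bar> \<le> 1" "r \<in> {0..1}" for \<nu> r
    using that M1[rule_format, of "(\<nu>, r)"] M2[rule_format, of "(\<nu>, r)"]
    by (auto simp: K_def M_def abs_le_iff intro: le_max_iff_disj[THEN iffD2])
  have M0: "0 \<le> M" using M(1)[of 0 0] by auto
  \<comment> \<open>The summand \<open>1\<close> avoids a division by zero when the remainder vanishes.\<close>
  define \<delta> where "\<delta> = min 1 (\<bar>a\<bar> / (4 * (M + 1)))"
  have \<delta>: "0 < \<delta>" "\<delta> \<le> 1" "4 * \<delta> * M \<le> \<bar>a\<bar>"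
  proof -
    have "\<delta> * (4 * (M + 1)) \<le> \<bar>a\<bar>"
      using mult_right_mono[of \<delta> "\<bar>a\<bar> / (4 * (M + 1))" "4 * (M + 1)"] M0 by (simp add: \<delta>_def)
    moreover have "0 < \<delta>" using a M0 by (simp add: \<delta>_def)
    ultimately show "0 < \<delta>" "4 * \<delta> * M \<le> \<bar>a\<bar>" by (auto simp: algebra_simps)
  qed (simp add: \<delta>_def)
  define \<epsilon> where "\<epsilon> = min 1 (\<delta>\<^sup>2 * \<bar>a\<bar> / 2)"
  have \<epsilon>: "0 < \<epsilon>" using a \<delta> by (simp add: \<epsilon>_def)
  let ?F = "\<lambda>\<nu> r. r * (\<nu> + a * r\<^sup>2)"
  let ?G = "\<lambda>\<nu> r. r * (\<nu> + a * r\<^sup>2) + r ^ (3 + 1) * g \<nu> r"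
  have "\<exists>h h'. homeomorphism {0..<\<delta>} {0..<\<delta>} h h' \<and> h 0 = 0 \<and>
      (\<forall>x\<in>{0..<\<delta>}. \<forall>y\<in>{0..<\<delta>}.
        scalar_reach (?F \<nu>) {0..<\<delta>} x y \<longleftrightarrow> scalar_reach (?G \<nu>) {0..<\<delta>} (h x) (h y))"
    if \<nu>: "\<bar>\<nu>\<bar> < \<epsilon>" for \<nu>
  proof -
    have \<nu>': "\<bar>\<nu>\<bar> < \<delta>\<^sup>2 * \<bar>a\<bar> / 2" "\<bar>\<nu>\<bar> \<le> 1" using \<nu> by (auto simp: \<epsilon>_def)
    obtain p where p: "0 \<le> p" "p < \<delta>" "p = 0 \<longleftrightarrow> 0 \<le> sgn a * \<nu>"
      "\<And>x. x \<in> {0..<\<delta>} \<Longrightarrow> sgn (?F \<nu> x) = sgn a * (sgn x * sgn (x - p))"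
      using sgn_amplitude_with_remainder[OF a \<delta> _ _ _ \<nu>'(1), of "\<lambda>_. 0" "\<lambda>_. 0"] M0
      by auto
    obtain q where q: "0 \<le> q" "q < \<delta>" "q = 0 \<longleftrightarrow> 0 \<le> sgn a * \<nu>"
      "\<And>x. x \<in> {0..<\<delta>} \<Longrightarrow> sgn (?G \<nu> x) = sgn a * (sgn x * sgn (x - q))"
      using sgn_amplitude_with_remainder[OF a \<delta> dg[of \<nu>] _ _ \<nu>'(1)] M[OF \<nu>'(2)] \<delta>(2)
      by auto
    have pq: "p = 0 \<longleftrightarrow> q = 0" using p q by simp
    define h where "h = broken_line \<delta> p q"
    have hom: "homeomorphism {0..<\<delta>} {0..<\<delta>} h (broken_line \<delta> q p)"
      unfolding h_def using broken_line_homeomorphism p q pq by blast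
    have less: "h x < h y" if "0 \<le> x" "x < y" for x y
      using broken_line_strict_mono[OF p(1,2) q(1,2) pq that(2)] that by (auto simp: h_def)
    have h0: "h 0 = 0" and hp: "h p = q"
      using p q pq by (auto simp: h_def broken_line_def)
    have sgn_h: "sgn (h x - h y) = sgn (x - y)" if "0 \<le> x" "0 \<le> y" for x y
      using less[of x y] less[of y x] that by (cases x y rule: linorder_cases) auto
    have "continuous_on UNIV (\<lambda>r. (\<nu>, r))" by (intro continuous_intros)
    then have "continuous_on UNIV (g \<nu>)" "continuous_on UNIV (g' \<nu>)"
      using continuous_on_compose2[OF gc _ subset_UNIV]
        continuous_on_compose2[OF g'c _ subset_UNIV] by fastforce+
    then have G: "C1_field (?G \<nu>)"
      unfolding C1_field_def
      by (intro exI[of _ "\<lambda>r. \<nu> + 3 * a * r\<^sup>2 + (4 * r ^ 3 * g \<nu> r + r ^ 4 * g' \<nu> r)"]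
            conjI allI continuous_intros)
         (auto intro!: derivative_eq_intros dg simp: algebra_simps power2_eq_square)
    have "scalar_reach (?F \<nu>) {0..<\<delta>} x y \<longleftrightarrow> scalar_reach (?G \<nu>) {0..<\<delta>} (h x) (h y)"
      if "x \<in> {0..<\<delta>}" "y \<in> {0..<\<delta>}" for x y
    proof (rule scalar_reach_conjugate[OF C1_field_pitchfork G _ _ _ _ _ that])
      show "bij_betw h {0..<\<delta>} {0..<\<delta>}"
        using hom by (auto simp: homeomorphism_def bij_betw_def intro: inj_on_inverseI)
      show "strict_mono_on {0..<\<delta>} h"
        by (rule strict_mono_onI) (use less in auto)
      fix x assume x: "x \<in> {0..<\<delta>}"
      then have hx: "h x \<in> {0..<\<delta>}" using hom by (auto simp: homeomorphism_def)
      show "sgn (?F \<nu> x) = sgn (?G \<nu> (h x))"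
        unfolding p(4)[OF x] q(4)[OF hx]
        using sgn_h[of x 0] sgn_h[of x p] x p(1) by (simp add: h0 hp)
    qed (auto simp: is_interval_co is_interval_1)
    then show ?thesis using hom h0 by blast
  qed
  then show "locally_equivalent_families ?F ?G"
    unfolding locally_equivalent_families_def using \<delta>(1) \<epsilon> by blast
qed

section \<open>Polar coordinates and phases\<close>

lemma polar_coordinates:
  fixes p :: "real \<times> real"
  obtains \<alpha> where "p = (norm p * cos \<alpha>, norm p * sin \<alpha>)"
proof (cases "p = 0")
  case False
  obtain x y where p: "p = (x, y)" by (cases p)
  have N: "(norm p)\<^sup>2 = x\<^sup>2 + y\<^sup>2" "norm p \<noteq> 0"
    using False by (auto simp: p norm_Pair zero_prod_def)
  have "(x / norm p)\<^sup>2 + (y / norm p)\<^sup>2 = 1"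
    using N(2) unfolding power_divide add_divide_distrib[symmetric] N(1)[symmetric] by simp
  then obtain \<alpha> where "x / norm p = cos \<alpha>" "y / norm p = sin \<alpha>"
    using sincos_total_2pi by metis
  then have *: "x = norm p * cos \<alpha>" "y = norm p * sin \<alpha>"
    using N(2) by (simp_all add: field_simps)
  show ?thesis by (rule that[of \<alpha>]) (unfold *[symmetric], rule p)
qed (use that[of 0] in \<open>simp add: zero_prod_def\<close>)

lemma norm_polar: "norm (r * cos \<alpha>, r * sin \<alpha>) = \<bar>r\<bar>" for r :: real
proof -
  have "(r * cos \<alpha>)\<^sup>2 + (r * sin \<alpha>)\<^sup>2 = r\<^sup>2"
    by (simp add: power_mult_distrib distrib_left[symmetric])
  then show ?thesis by (simp add: norm_Pair)
qed

text \<open>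
  Stated for intervals of the forms \<open>{0..T}\<close> and \<open>{0..}\<close> alike, since both occur as time domains.
  Locally at \<open>t\<close>, the interval is \<open>{0..s}\<close> with some \<open>s \<ge> t\<close> in it, where the fundamental theorem of
  calculus applies.
\<close>

lemma antiderivative_on_interval:
  fixes q :: "real \<Rightarrow> real"
  assumes I: "is_interval I" "0 \<in> I" "I \<subseteq> {0..}" and q: "continuous_on I q"
  shows "\<exists>\<Theta>. \<Theta> 0 = \<alpha> \<and> (\<forall>t\<in>I. (\<Theta> has_real_derivative q t) (at t within I))"
proof -
  let ?\<Theta> = "\<lambda>t. \<alpha> + integral {0..t} q"
  have D: "(?\<Theta> has_real_derivative q t) (at t within {0..s})" if "s \<in> I" "t \<in> {0..s}" for s t
  proof -
    have "continuous_on {0..s} q"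
      using is_interval_Icc_subset[OF I(1,2) that(1)] q continuous_on_subset by blast
    then show ?thesis
      using integral_has_real_derivative[OF _ that(2)] by (auto intro!: derivative_eq_intros)
  qed
  have "(?\<Theta> has_real_derivative q t) (at t within I)" if t: "t \<in> I" for t
  proof (cases "\<exists>s\<in>I. t < s")
    case True
    then obtain s where s: "s \<in> I" "t < s" by blast
    have "at t within I = at t within {0..s}"
    proof (rule at_within_nhd[of t "{..<s}"])
      show "I \<inter> {..<s} - {t} = {0..s} \<inter> {..<s} - {t}"
        using is_interval_Icc_subset[OF I(1,2) s(1)] I(3) by auto
    qed (use s in auto)
    then show ?thesis using D[of s t] s t I(3) by auto
  next
    case False
    then have "I \<subseteq> {0..t}" using I(3) by force
    moreover have "0 \<le> t" using t I(3) by auto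
    ultimately show ?thesis using DERIV_subset[OF D[of t t]] t by simp
  qed
  then show ?thesis by (intro exI[of _ ?\<Theta>]) simp
qed

section \<open>Geometry of the closed leaf\<close>

locale leaf_geometry =
  fixes n k :: nat and \<sigma> :: "nat \<Rightarrow> nat" and c :: "nat \<Rightarrow> real"
  assumes k: "1 \<le> k" "k \<le> n"
    and \<sigma>: "\<sigma> \<in> shuffle_perms n k"
    and c: "c \<in> pos_sphere n k \<sigma>"
begin

definition ratio :: "nat \<Rightarrow> real" where
  "ratio i = c i / c (\<sigma> k)"

text \<open>
  The points of the closed leaf with \<open>\<rho>\<^sub>\<sigma>\<^sub>k = r\<close>. A single condition for all indices replaces the case
  distinctions in the leaf and includes the origin as \<open>r = 0\<close>, because \<open>ratio\<close> vanishes at the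
  indices where the points of the leaf do.
\<close>

definition shell :: "real \<Rightarrow> state set" where
  "shell r = {z. \<forall>i. norm (z i) = ratio i * r}"

lemma permutes: "\<sigma> permutes {1..n}"
  using \<sigma> by (simp add: shuffle_perms_def)

lemma c_pos: "j \<in> {1..k} \<Longrightarrow> 0 < c (\<sigma> j)"
  using c by (simp add: pos_sphere_def)

lemma c_k_pos: "0 < c (\<sigma> k)"
  using c_pos[of k] k by simp

lemma index_cases:
  obtains j where "j \<in> {1..k}" "i = \<sigma> j" | j where "j \<in> {k<..n}" "i = \<sigma> j" | "i \<notin> {1..n}"
proof (cases "i \<in> {1..n}")
  case True
  then obtain j where "j \<in> {1..n}" "i = \<sigma> j"
    using permutes_image[OF permutes] by blast
  then show ?thesis using that(1)[of j] that(2)[of j] by (cases "j \<le> k") simp_all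
qed (use that in auto)

lemma ratio_outside:
  shows "j \<in> {k<..n} \<Longrightarrow> ratio (\<sigma> j) = 0" and "i \<notin> {1..n} \<Longrightarrow> ratio i = 0"
  using c by (auto simp: ratio_def pos_sphere_def)

lemma ratio_pos: "j \<in> {1..k} \<Longrightarrow> 0 < ratio (\<sigma> j)"
  using c_pos c_k_pos by (simp add: ratio_def)

lemma ratio_nonneg: "0 \<le> ratio i"
  using index_cases[of i] ratio_pos ratio_outside by (metis order.refl less_imp_le)

lemma ratio_k: "ratio (\<sigma> k) = 1"
  using c_k_pos by (simp add: ratio_def)

lemma norm_shell: "z \<in> shell r \<Longrightarrow> norm (z (\<sigma> k)) = r"
  by (simp add: shell_def ratio_k)

lemma shell_0: "shell 0 = {origin}"
  by (auto simp: shell_def origin_def)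

lemma hypertorus_eq_shell:
  assumes "0 < r"
  shows "hypertorus n k \<sigma> c r = shell r"
proof (intro equalityI subsetI)
  fix z assume z: "z \<in> hypertorus n k \<sigma> c r"
  have "norm (z i) = ratio i * r" for i
    by (cases i rule: index_cases)
       (use z in \<open>auto simp: hypertorus_def leaf_def ratio_outside ratio_def[symmetric]\<close>)
  then show "z \<in> shell r" by (simp add: shell_def)
next
  fix z assume z: "z \<in> shell r"
  then have nz: "norm (z i) = ratio i * r" for i unfolding shell_def by blast
  have "norm (z (\<sigma> i)) = ratio (\<sigma> i) * norm (z (\<sigma> k)) \<and> 0 < norm (z (\<sigma> i))" if "i \<in> {1..k}" for i
    unfolding nz using ratio_pos[OF that] \<open>0 < r\<close> ratio_k by simp
  moreover have "z i = 0" if "ratio i = 0" for i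
    using nz[of i] that by simp
  ultimately show "z \<in> hypertorus n k \<sigma> c r"
    using norm_shell[OF z] ratio_outside
    unfolding hypertorus_def leaf_def ratio_def[symmetric] by blast
qed

lemma closed_leaf_iff: "z \<in> closed_leaf n k \<sigma> c \<longleftrightarrow> z \<in> shell (norm (z (\<sigma> k)))"
proof (cases "z (\<sigma> k) = 0")
  case True
  have "z \<notin> leaf n k \<sigma> c" using True k by (auto simp: leaf_def)
  then show ?thesis using True by (simp add: closed_leaf_def shell_0)
next
  case False
  then have "z \<noteq> origin" by (auto simp: origin_def)
  moreover have "z \<in> leaf n k \<sigma> c \<longleftrightarrow> z \<in> hypertorus n k \<sigma> c (norm (z (\<sigma> k)))"
    by (simp add: hypertorus_def)
  ultimately show ?thesis using False by (simp add: closed_leaf_def hypertorus_eq_shell)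
qed

lemma shell_subset_closed_leaf: "z \<in> shell r \<Longrightarrow> z \<in> closed_leaf n k \<sigma> c"
  using closed_leaf_iff norm_shell by metis

lemma shell_scale: "z \<in> shell r \<Longrightarrow> 0 \<le> s \<Longrightarrow> (\<lambda>i. s *\<^sub>R z i) \<in> shell (s * r)"
  by (simp add: shell_def)

lemma closed_leaf_scale:
  "z \<in> closed_leaf n k \<sigma> c \<Longrightarrow> 0 \<le> s \<Longrightarrow> (\<lambda>i. s *\<^sub>R z i) \<in> closed_leaf n k \<sigma> c"
  by (rule shell_subset_closed_leaf[OF shell_scale]) (simp_all add: closed_leaf_iff)

lemma shell_nonempty:
  assumes "0 \<le> r"
  obtains z where "z \<in> shell r"
proof
  show "(\<lambda>i. (ratio i * r, 0)) \<in> shell r"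
    using assms ratio_nonneg by (simp add: shell_def norm_Pair)
qed

text \<open>
  A shell is a product of circles and points.
\<close>

lemma compact_shell: "compact (shell r)"
proof -
  have "shell r = (\<Pi>\<^sub>E i\<in>UNIV. sphere 0 (ratio i * r))"
    by (auto simp: shell_def PiE_iff)
  moreover have "compactin (product_topology (\<lambda>_. euclidean) UNIV)
      (\<Pi>\<^sub>E i\<in>UNIV. sphere (0 :: real \<times> real) (ratio i * r))"
    by (subst compactin_PiE) auto
  ultimately show ?thesis by (simp add: euclidean_product_topology)
qed

text \<open>
  Shells vary continuously with the radius, even at \<open>0\<close>: the shell of radius \<open>r\<close> is the image of the
  compact shell of radius \<open>1\<close> under multiplication by \<open>r\<close>, and the tube lemma gives a neighbourhood of
  \<open>r0\<close> whose multiples all lie in \<open>U\<close>.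
\<close>

lemma shell_nearby:
  assumes U: "open U" "shell r0 \<subseteq> U"
  obtains \<eta> where "0 < \<eta>" "\<And>r. 0 \<le> r \<Longrightarrow> \<bar>r - r0\<bar> < \<eta> \<Longrightarrow> shell r \<subseteq> U"
proof (cases "0 \<le> r0")
  case True
  let ?m = "\<lambda>(s, z :: state) i. s *\<^sub>R z i :: real \<times> real"
  have coord: "continuous_on UNIV (\<lambda>x :: real \<times> state. fst x *\<^sub>R snd x i)" for i
    by (intro continuous_intros continuous_on_compose2[OF continuous_on_product_coordinates]) auto
  have "continuous_on UNIV ?m"
    unfolding case_prod_unfold by (rule continuous_on_coordinatewise_then_product[OF coord])
  then have W: "open (?m -` U)"
    using U(1) by (simp add: continuous_on_open_vimage)
  have "{r0} \<times> shell 1 \<subseteq> ?m -` U"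
  proof -
    have "(\<lambda>i. r0 *\<^sub>R w i) \<in> U" if "w \<in> shell 1" for w
      using shell_scale[OF that True] U(2) by auto
    then show ?thesis by auto
  qed
  from Elementary_Topology.tube_lemma[OF compact_shell W this]
  obtain X where X: "r0 \<in> X" "open X" "X \<times> shell 1 \<subseteq> ?m -` U" by blast
  then obtain \<eta> where \<eta>: "0 < \<eta>" "ball r0 \<eta> \<subseteq> X" by (meson openE)
  have "shell r \<subseteq> U" if r: "0 \<le> r" "\<bar>r - r0\<bar> < \<eta>" for r
  proof
    fix z assume z: "z \<in> shell r"
    have "r \<in> X" using \<eta> r by (auto simp: dist_real_def abs_minus_commute)
    obtain w where w: "w \<in> shell 1" "z = (\<lambda>i. r *\<^sub>R w i)"
    proof (cases "r = 0")
      case True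
      then have "z = (\<lambda>i. r *\<^sub>R w i)" for w using z by (simp add: shell_0 origin_def)
      then show ?thesis using that shell_nonempty[of 1] by (metis zero_le_one)
    next
      case False
      have "(\<lambda>i. (1 / r) *\<^sub>R z i) \<in> shell (1 / r * r)"
        using z r by (intro shell_scale) auto
      then show ?thesis using that[of "\<lambda>i. (1 / r) *\<^sub>R z i"] False by simp
    qed
    then show "z \<in> U" using X(3) \<open>r \<in> X\<close> by auto
  qed
  then show ?thesis using that \<eta> by blast
next
  case False
  \<comment> \<open>A negative \<open>r0\<close> has a neighbourhood without any radius.\<close>
  then show ?thesis using that[of "- r0"] by auto
qed

section \<open>Motions on the leaf and the amplitude equation\<close>

lemma radius_solution:
  assumes z: "leaf_normal_form n k \<sigma> c s \<nu> \<omega> b I z" and t: "t \<in> I"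
  shows "((\<lambda>t. norm (z t (\<sigma> k))) has_real_derivative amplitude s \<nu> (norm (z t (\<sigma> k)))) (at t within I)"
proof -
  obtain \<rho> \<theta> :: "nat \<Rightarrow> real \<Rightarrow> real" where R: "\<forall>i\<in>{1..k}. \<forall>t\<in>I.
        \<rho> (\<sigma> i) t \<ge> 0 \<and>
        z t (\<sigma> i) = (\<rho> (\<sigma> i) t * cos (\<theta> (\<sigma> i) t), \<rho> (\<sigma> i) t * sin (\<theta> (\<sigma> i) t)) \<and>
        (\<rho> (\<sigma> i) has_real_derivative
           \<rho> (\<sigma> i) t * (\<Sum>j=0..s. \<nu> j * \<rho> (\<sigma> k) t ^ (2 * j))) (at t within I)"
    using z unfolding leaf_normal_form_def by blast
  have "k \<in> {1..k}" using k by simp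
  note \<rho> = R[rule_format, OF this]
  have eq: "norm (z t (\<sigma> k)) = \<rho> (\<sigma> k) t" if "t \<in> I" for t
    using \<rho>[OF that] by (simp add: norm_polar)
  have "(\<rho> (\<sigma> k) has_real_derivative amplitude s \<nu> (norm (z t (\<sigma> k)))) (at t within I)"
    using \<rho>[OF t] unfolding eq[OF t] amplitude_def by blast
  then show ?thesis
    by (rule has_field_derivative_transform_within[OF _ zero_less_one t]) (simp add: eq)
qed

lemma normal_form_phase_space:
  "leaf_normal_form n k \<sigma> c s \<nu> \<omega> b I z \<Longrightarrow> t \<in> I \<Longrightarrow> z t \<in> shell (norm (z t (\<sigma> k)))"
  unfolding leaf_normal_form_def closed_leaf_iff by blast

lemma normal_form_subset:
  assumes z: "leaf_normal_form n k \<sigma> c s \<nu> \<omega> b I z" and "J \<subseteq> I"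
  shows "leaf_normal_form n k \<sigma> c s \<nu> \<omega> b J z"
proof -
  obtain \<rho> \<theta> :: "nat \<Rightarrow> real \<Rightarrow> real" where R: "\<forall>i\<in>{1..k}. \<forall>t\<in>I.
        \<rho> (\<sigma> i) t \<ge> 0 \<and>
        z t (\<sigma> i) = (\<rho> (\<sigma> i) t * cos (\<theta> (\<sigma> i) t), \<rho> (\<sigma> i) t * sin (\<theta> (\<sigma> i) t)) \<and>
        (\<rho> (\<sigma> i) has_real_derivative
           \<rho> (\<sigma> i) t * (\<Sum>j=0..s. \<nu> j * \<rho> (\<sigma> k) t ^ (2 * j))) (at t within I) \<and>
        (\<theta> (\<sigma> i) has_real_derivative
           \<omega> (\<sigma> i) + (\<Sum>j=0..s. b i j * \<rho> (\<sigma> k) t ^ (2 * j))) (at t within I)"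
    using z unfolding leaf_normal_form_def by blast
  show ?thesis
    unfolding leaf_normal_form_def
  proof (rule conjI, use z \<open>J \<subseteq> I\<close> in \<open>force simp: leaf_normal_form_def\<close>,
      rule exI[of _ \<rho>], rule exI[of _ \<theta>], intro ballI)
    fix i t assume "i \<in> {1..k}" "t \<in> J"
    then show "\<rho> (\<sigma> i) t \<ge> 0 \<and>
        z t (\<sigma> i) = (\<rho> (\<sigma> i) t * cos (\<theta> (\<sigma> i) t), \<rho> (\<sigma> i) t * sin (\<theta> (\<sigma> i) t)) \<and>
        (\<rho> (\<sigma> i) has_real_derivative
           \<rho> (\<sigma> i) t * (\<Sum>j=0..s. \<nu> j * \<rho> (\<sigma> k) t ^ (2 * j))) (at t within J) \<and>
        (\<theta> (\<sigma> i) has_real_derivative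
           \<omega> (\<sigma> i) + (\<Sum>j=0..s. b i j * \<rho> (\<sigma> k) t ^ (2 * j))) (at t within J)"
      using R \<open>J \<subseteq> I\<close> DERIV_subset[OF _ \<open>J \<subseteq> I\<close>] by blast
  qed
qed

text \<open>
  Once \<open>u\<close> is known, the angular velocities are known continuous functions of time, so the phases are
  antiderivatives that start at the arguments of the coordinates of \<open>p\<close>. The index \<open>i\<close> has the phase
  coefficients with number \<open>inv \<sigma> i\<close>.
\<close>

lemma normal_form_lift:
  assumes I: "is_interval I" "0 \<in> I" "I \<subseteq> {0..}" and p: "p \<in> shell (u 0)"
    and u: "\<And>t. t \<in> I \<Longrightarrow> 0 \<le> u t"
      "\<And>t. t \<in> I \<Longrightarrow> (u has_real_derivative amplitude s \<nu> (u t)) (at t within I)"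
  obtains z where "leaf_normal_form n k \<sigma> c s \<nu> \<omega> b I z" "z 0 = p"
    "\<And>t. t \<in> I \<Longrightarrow> norm (z t (\<sigma> k)) = u t"
proof -
  have u_cont: "continuous_on I u" by (rule DERIV_continuous_on[OF u(2)])
  have "\<exists>\<alpha>. p i = (norm (p i) * cos \<alpha>, norm (p i) * sin \<alpha>)" for i
    by (rule polar_coordinates[of "p i"]) (rule exI)
  then have "\<exists>\<alpha>. \<forall>i. p i = (norm (p i) * cos (\<alpha> i), norm (p i) * sin (\<alpha> i))"
    by (intro choice allI)
  then obtain \<alpha> where \<alpha>: "\<And>i. p i = (norm (p i) * cos (\<alpha> i), norm (p i) * sin (\<alpha> i))"
    by (elim exE) (rule that, erule spec)
  define rate where "rate i t = \<omega> i + (\<Sum>j=0..s. b (inv \<sigma> i) j * u t ^ (2 * j))" for i t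
  have "\<exists>\<Theta>. \<Theta> 0 = \<alpha> i \<and> (\<forall>t\<in>I. (\<Theta> has_real_derivative rate i t) (at t within I))" for i
    by (rule antiderivative_on_interval[OF I]) (auto simp: rate_def intro!: continuous_intros u_cont)
  then have "\<exists>\<Theta>. \<forall>i. \<Theta> i 0 = \<alpha> i \<and>
      (\<forall>t\<in>I. (\<Theta> i has_real_derivative rate i t) (at t within I))"
    by (intro choice allI)
  then obtain \<Theta> where \<Theta>: "\<And>i. \<Theta> i 0 = \<alpha> i"
    "\<And>i t. t \<in> I \<Longrightarrow> (\<Theta> i has_real_derivative rate i t) (at t within I)"
    by blast
  define \<rho> where "\<rho> i t = ratio i * u t" for i t
  define z where "z t i = (\<rho> i t * cos (\<Theta> i t), \<rho> i t * sin (\<Theta> i t))" for t i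
  have shell: "z t \<in> shell (u t)" if "t \<in> I" for t
    using u(1)[OF that] ratio_nonneg by (simp add: shell_def z_def norm_polar \<rho>_def)
  show ?thesis
  proof (rule that[of z])
    show "z 0 = p"
    proof
      fix i
      have "norm (p i) = \<rho> i 0" using p by (simp add: shell_def \<rho>_def)
      then show "z 0 i = p i" using \<alpha>[of i] by (simp add: z_def \<Theta>(1))
    qed
    show "norm (z t (\<sigma> k)) = u t" if "t \<in> I" for t
      using norm_shell[OF shell[OF that]] .
    show "leaf_normal_form n k \<sigma> c s \<nu> \<omega> b I z"
      unfolding leaf_normal_form_def
    proof (rule conjI, use shell shell_subset_closed_leaf in blast,
        rule exI[of _ \<rho>], rule exI[of _ \<Theta>], intro conjI ballI)
      fix i t assume i: "i \<in> {1..k}" and t: "t \<in> I"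
      have \<rho>k: "\<rho> (\<sigma> k) t = u t" by (simp add: \<rho>_def ratio_k)
      show "0 \<le> \<rho> (\<sigma> i) t" using u(1)[OF t] ratio_nonneg by (simp add: \<rho>_def)
      show "z t (\<sigma> i) = (\<rho> (\<sigma> i) t * cos (\<Theta> (\<sigma> i) t), \<rho> (\<sigma> i) t * sin (\<Theta> (\<sigma> i) t))"
        by (simp add: z_def)
      have "((\<lambda>t. ratio (\<sigma> i) * u t) has_real_derivative ratio (\<sigma> i) * amplitude s \<nu> (u t)) (at t within I)"
        by (rule DERIV_cmult[OF u(2)[OF t]])
      then show "(\<rho> (\<sigma> i) has_real_derivative
          \<rho> (\<sigma> i) t * (\<Sum>j=0..s. \<nu> j * \<rho> (\<sigma> k) t ^ (2 * j))) (at t within I)"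
        unfolding \<rho>k amplitude_def by (simp add: \<rho>_def[abs_def] mult.assoc)
      have "inv \<sigma> (\<sigma> i) = i" using permutes_inverses(2)[OF permutes] .
      then show "(\<Theta> (\<sigma> i) has_real_derivative
          \<omega> (\<sigma> i) + (\<Sum>j=0..s. b i j * \<rho> (\<sigma> k) t ^ (2 * j))) (at t within I)"
        using \<Theta>(2)[OF t, of "\<sigma> i"] unfolding \<rho>k rate_def by simp
    qed
  qed
qed

text \<open>
  The frequencies and phase coefficients do not occur on the right: reachability of hypertori is a
  matter of the amplitude alone.
\<close>

lemma torus_reach_iff:
  assumes p: "p \<in> closed_leaf n k \<sigma> c"
  shows "torus_reach k \<sigma> (leaf_normal_form n k \<sigma> c s \<nu> \<omega> b) p q \<longleftrightarrow>
    scalar_reach (amplitude s \<nu>) {0..} (norm (p (\<sigma> k))) (norm (q (\<sigma> k)))"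
proof
  assume "torus_reach k \<sigma> (leaf_normal_form n k \<sigma> c s \<nu> \<omega> b) p q"
  then obtain T z where "0 \<le> T" "leaf_normal_form n k \<sigma> c s \<nu> \<omega> b {0..T} z" "z 0 = p"
    "norm (z T (\<sigma> k)) = norm (q (\<sigma> k))"
    unfolding torus_reach_def by blast
  then show "scalar_reach (amplitude s \<nu>) {0..} (norm (p (\<sigma> k))) (norm (q (\<sigma> k)))"
    unfolding scalar_reach_def
    by (intro exI[of _ T] exI[of _ "\<lambda>t. norm (z t (\<sigma> k))"] conjI) (auto intro: radius_solution)
next
  assume "scalar_reach (amplitude s \<nu>) {0..} (norm (p (\<sigma> k))) (norm (q (\<sigma> k)))"
  then obtain T u where T: "0 \<le> T" "u 0 = norm (p (\<sigma> k))" "u T = norm (q (\<sigma> k))"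
    and u: "\<And>t. t \<in> {0..T} \<Longrightarrow> 0 \<le> u t"
      "\<And>t. t \<in> {0..T} \<Longrightarrow> (u has_real_derivative amplitude s \<nu> (u t)) (at t within {0..T})"
    unfolding scalar_reach_def by fastforce
  have "p \<in> shell (u 0)" using p by (simp add: T closed_leaf_iff)
  with T u obtain z where "leaf_normal_form n k \<sigma> c s \<nu> \<omega> b {0..T} z" "z 0 = p"
    "\<And>t. t \<in> {0..T} \<Longrightarrow> norm (z t (\<sigma> k)) = u t"
    using normal_form_lift[of "{0..T}" p u s \<nu> \<omega> b] by (auto simp: is_interval_cc)
  then show "torus_reach k \<sigma> (leaf_normal_form n k \<sigma> c s \<nu> \<omega> b) p q"
    unfolding torus_reach_def using T by (intro exI[of _ T] exI[of _ z]) auto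
qed

text \<open>
  Reversed motions solve the normal form with all coefficients negated. As this operation is an
  involution, one inclusion yields the equality of systems.
\<close>

lemma normal_form_reversed:
  assumes z: "leaf_normal_form n k \<sigma> c s \<nu> \<omega> b (uminus ` I) (\<lambda>t. z (- t))"
  shows "leaf_normal_form n k \<sigma> c s (\<lambda>j. - \<nu> j) (\<lambda>i. - \<omega> i) (\<lambda>i j. - b i j) I z"
proof -
  obtain \<rho> \<theta> :: "nat \<Rightarrow> real \<Rightarrow> real" where R: "\<And>i t. i \<in> {1..k} \<Longrightarrow> t \<in> uminus ` I \<Longrightarrow>
        \<rho> (\<sigma> i) t \<ge> 0 \<and>
        z (- t) (\<sigma> i) = (\<rho> (\<sigma> i) t * cos (\<theta> (\<sigma> i) t), \<rho> (\<sigma> i) t * sin (\<theta> (\<sigma> i) t)) \<and>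
        (\<rho> (\<sigma> i) has_real_derivative
           \<rho> (\<sigma> i) t * (\<Sum>j=0..s. \<nu> j * \<rho> (\<sigma> k) t ^ (2 * j))) (at t within uminus ` I) \<and>
        (\<theta> (\<sigma> i) has_real_derivative
           \<omega> (\<sigma> i) + (\<Sum>j=0..s. b i j * \<rho> (\<sigma> k) t ^ (2 * j))) (at t within uminus ` I)"
    using z unfolding leaf_normal_form_def by blast
  have phase: "\<forall>t\<in>I. z t \<in> closed_leaf n k \<sigma> c"
    using z unfolding leaf_normal_form_def by simp
  show ?thesis
    unfolding leaf_normal_form_def
  proof (rule conjI[OF phase],
      rule exI[of _ "\<lambda>i t. \<rho> i (- t)"], rule exI[of _ "\<lambda>i t. \<theta> i (- t)"], intro conjI ballI)
    fix i t assume i: "i \<in> {1..k}" and "t \<in> I"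
    then have t: "- t \<in> uminus ` I" by blast
    note Rit = R[OF i t]
    show "0 \<le> \<rho> (\<sigma> i) (- t)"
      "z t (\<sigma> i) = (\<rho> (\<sigma> i) (- t) * cos (\<theta> (\<sigma> i) (- t)), \<rho> (\<sigma> i) (- t) * sin (\<theta> (\<sigma> i) (- t)))"
      using Rit by simp_all
    show "((\<lambda>t. \<rho> (\<sigma> i) (- t)) has_real_derivative
        \<rho> (\<sigma> i) (- t) * (\<Sum>j=0..s. - \<nu> j * \<rho> (\<sigma> k) (- t) ^ (2 * j))) (at t within I)"
      "((\<lambda>t. \<theta> (\<sigma> i) (- t)) has_real_derivative
        - \<omega> (\<sigma> i) + (\<Sum>j=0..s. - b i j * \<rho> (\<sigma> k) (- t) ^ (2 * j))) (at t within I)"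
      using Rit DERIV_reflect_within[of "\<rho> (\<sigma> i)" _ t I] DERIV_reflect_within[of "\<theta> (\<sigma> i)" _ t I]
      by (fastforce simp: sum_negf)+
  qed
qed

lemma time_reversal_normal_form:
  "time_reversal (leaf_normal_form n k \<sigma> c s \<nu> \<omega> b) =
    leaf_normal_form n k \<sigma> c s (\<lambda>j. - \<nu> j) (\<lambda>i. - \<omega> i) (\<lambda>i j. - b i j)"
proof (intro ext iffI)
  fix I z
  show "leaf_normal_form n k \<sigma> c s (\<lambda>j. - \<nu> j) (\<lambda>i. - \<omega> i) (\<lambda>i j. - b i j) I z"
    if "time_reversal (leaf_normal_form n k \<sigma> c s \<nu> \<omega> b) I z"
    using that unfolding time_reversal_def by (rule normal_form_reversed)
  show "time_reversal (leaf_normal_form n k \<sigma> c s \<nu> \<omega> b) I z"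
    if "leaf_normal_form n k \<sigma> c s (\<lambda>j. - \<nu> j) (\<lambda>i. - \<omega> i) (\<lambda>i j. - b i j) I z"
    using normal_form_reversed[of s "\<lambda>j. - \<nu> j" "\<lambda>i. - \<omega> i" "\<lambda>i j. - b i j" "uminus ` I" "\<lambda>t. z (- t)"] that
    by (simp add: time_reversal_def image_image)
qed

lemma shell_flow_invariant:
  assumes "C1_field (amplitude s \<nu>)" "amplitude s \<nu> r = 0"
  shows "flow_invariant (leaf_normal_form n k \<sigma> c s \<nu> \<omega> b) (shell r)"
  unfolding flow_invariant_def
proof (intro allI impI ballI, elim conjE bexE)
  fix I z t t0
  assume I: "is_interval I" "t \<in> I" "t0 \<in> I" and z: "leaf_normal_form n k \<sigma> c s \<nu> \<omega> b I z"
    and "z t0 \<in> shell r"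
  have "norm (z t (\<sigma> k)) = r"
    by (rule constant_at_equilibrium[where u = "\<lambda>t. norm (z t (\<sigma> k))", OF assms I(1)
          radius_solution[OF z] I(3) norm_shell[OF \<open>z t0 \<in> shell r\<close>] I(2)])
  then show "z t \<in> shell r"
    using normal_form_phase_space[OF z I(2)] by simp
qed

lemma open_radius_vimage:
  assumes "open X"
  shows "open {z :: state. norm (z (\<sigma> k)) \<in> X}"
proof -
  have "continuous_on UNIV (\<lambda>z :: state. norm (z (\<sigma> k)))"
    by (intro continuous_on_norm continuous_on_product_coordinates)
  then show ?thesis
    using assms continuous_on_open_vimage[of UNIV "\<lambda>z :: state. norm (z (\<sigma> k))"]
    by (auto simp: vimage_def)
qed

text \<open>
  The neighbourhoods of a shell that are needed are those of the form \<open>\<bar>\<rho> - r\<bar> < \<delta>\<close>; inside the closed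
  leaf they are a basis of neighbourhoods by compactness.
\<close>

lemma shell_lyapunov_stable:
  assumes stable: "\<And>\<eta>. 0 < \<eta> \<Longrightarrow> \<exists>\<delta>>0. \<forall>x\<ge>0. \<forall>y\<ge>0. \<bar>x - r\<bar> < \<delta> \<longrightarrow>
      scalar_reach (amplitude s \<nu>) {0..} x y \<longrightarrow> \<bar>y - r\<bar> < \<eta>"
  shows "lyapunov_stable (leaf_normal_form n k \<sigma> c s \<nu> \<omega> b) (shell r)"
  unfolding lyapunov_stable_def
proof (intro allI impI, elim conjE)
  fix U :: "state set" assume U: "open U" "shell r \<subseteq> U"
  obtain \<eta> where \<eta>: "0 < \<eta>" "\<And>y. 0 \<le> y \<Longrightarrow> \<bar>y - r\<bar> < \<eta> \<Longrightarrow> shell y \<subseteq> U"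
    using shell_nearby[OF U] by blast
  obtain \<delta> where \<delta>: "0 < \<delta>" "\<And>x y. 0 \<le> x \<Longrightarrow> 0 \<le> y \<Longrightarrow> \<bar>x - r\<bar> < \<delta> \<Longrightarrow>
      scalar_reach (amplitude s \<nu>) {0..} x y \<Longrightarrow> \<bar>y - r\<bar> < \<eta>"
    using stable[OF \<eta>(1)] by blast
  let ?V = "{z :: state. norm (z (\<sigma> k)) \<in> ball r \<delta>}"
  have "z T \<in> U" if "0 \<le> T" "leaf_normal_form n k \<sigma> c s \<nu> \<omega> b {0..T} z" "z 0 \<in> ?V" for T z
  proof -
    have "z 0 \<in> closed_leaf n k \<sigma> c"
      using that by (auto simp: leaf_normal_form_def)
    moreover have "torus_reach k \<sigma> (leaf_normal_form n k \<sigma> c s \<nu> \<omega> b) (z 0) (z T)"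
      unfolding torus_reach_def using that by blast
    ultimately have "scalar_reach (amplitude s \<nu>) {0..} (norm (z 0 (\<sigma> k))) (norm (z T (\<sigma> k)))"
      by (simp add: torus_reach_iff)
    moreover have "\<bar>norm (z 0 (\<sigma> k)) - r\<bar> < \<delta>"
      using that(3) by (simp add: dist_real_def abs_minus_commute)
    ultimately have "\<bar>norm (z T (\<sigma> k)) - r\<bar> < \<eta>"
      using \<delta>(2) norm_ge_zero by blast
    then show ?thesis
      using \<eta>(2)[of "norm (z T (\<sigma> k))"] normal_form_phase_space[OF that(2), of T] that(1) by auto
  qed
  moreover have "open ?V" by (rule open_radius_vimage) simp
  moreover have "shell r \<subseteq> ?V" using norm_shell \<delta>(1) by auto
  ultimately show "\<exists>V. open V \<and> shell r \<subseteq> V \<and>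
      (\<forall>T\<ge>0. \<forall>z. leaf_normal_form n k \<sigma> c s \<nu> \<omega> b {0..T} z \<and> z 0 \<in> V \<longrightarrow> z T \<in> U)"
    by blast
qed

lemma shell_attracting:
  assumes "0 < \<delta>"
    and global: "\<And>x. 0 \<le> x \<Longrightarrow> \<bar>x - r\<bar> < \<delta> \<Longrightarrow> \<exists>u. u 0 = x \<and> (\<forall>t\<ge>0. 0 \<le> u t \<and>
        (u has_real_derivative amplitude s \<nu> (u t)) (at t within {0..}))"
    and limit: "\<And>u. \<bar>u 0 - r\<bar> < \<delta> \<Longrightarrow> (\<And>t. 0 \<le> t \<Longrightarrow> 0 \<le> u t) \<Longrightarrow>
      (\<And>t. 0 \<le> t \<Longrightarrow> (u has_real_derivative amplitude s \<nu> (u t)) (at t within {0..})) \<Longrightarrow>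
      (u \<longlongrightarrow> r) at_top"
  shows "attracting (closed_leaf n k \<sigma> c) (leaf_normal_form n k \<sigma> c s \<nu> \<omega> b) (shell r)"
  unfolding attracting_def
proof (intro exI[of _ "{z. norm (z (\<sigma> k)) \<in> ball r \<delta>}"] conjI ballI allI impI)
  show "open {z :: state. norm (z (\<sigma> k)) \<in> ball r \<delta>}" by (rule open_radius_vimage) simp
  show "shell r \<subseteq> {z. norm (z (\<sigma> k)) \<in> ball r \<delta>}" using norm_shell \<open>0 < \<delta>\<close> by auto
next
  fix p assume p: "p \<in> {z. norm (z (\<sigma> k)) \<in> ball r \<delta>} \<inter> closed_leaf n k \<sigma> c"
  then have near: "\<bar>norm (p (\<sigma> k)) - r\<bar> < \<delta>" by (simp add: dist_real_def abs_minus_commute)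
  then obtain u where u: "u 0 = norm (p (\<sigma> k))" "\<And>t. 0 \<le> t \<Longrightarrow> 0 \<le> u t"
    "\<And>t. 0 \<le> t \<Longrightarrow> (u has_real_derivative amplitude s \<nu> (u t)) (at t within {0..})"
    using global[of "norm (p (\<sigma> k))"] by auto
  have "p \<in> shell (u 0)" using p by (simp add: u(1) closed_leaf_iff)
  then show "\<exists>z. leaf_normal_form n k \<sigma> c s \<nu> \<omega> b {0..} z \<and> z 0 = p"
    using normal_form_lift[of "{0..}" p u s \<nu> \<omega> b] u by (auto simp: is_interval_ci)
  fix z U assume z: "leaf_normal_form n k \<sigma> c s \<nu> \<omega> b {0..} z \<and> z 0 = p" and U: "open U \<and> shell r \<subseteq> U"
  obtain \<eta> where \<eta>: "0 < \<eta>" "\<And>y. 0 \<le> y \<Longrightarrow> \<bar>y - r\<bar> < \<eta> \<Longrightarrow> shell y \<subseteq> U"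
    using shell_nearby U by blast
  have "((\<lambda>t. norm (z t (\<sigma> k))) \<longlongrightarrow> r) at_top"
    using radius_solution[of s \<nu> \<omega> b "{0..}" z] z near by (intro limit) auto
  then have "\<forall>\<^sub>F t in at_top. dist (norm (z t (\<sigma> k))) r < \<eta>"
    using \<eta>(1) by (rule tendstoD)
  then show "\<forall>\<^sub>F t in at_top. z t \<in> U"
    using eventually_ge_at_top[of 0]
  proof eventually_elim
    case (elim t)
    then have "z t \<in> shell (norm (z t (\<sigma> k)))"
      using z normal_form_phase_space by (metis atLeast_iff)
    then show ?case using \<eta>(2)[of "norm (z t (\<sigma> k))"] elim by (auto simp: dist_real_def)
  qed
qed

end

section \<open>Solutions and limits of the cubic amplitude equation\<close>

lemma amplitude_coeffs1: "amplitude 1 (coeffs1 a \<nu>) = (\<lambda>r. r * (\<nu> + a * r\<^sup>2))"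
  by (simp add: amplitude_def coeffs1_def fun_eq_iff)

lemma pitchfork_factor:
  fixes a \<nu> R r :: real
  assumes "\<nu> = - a * R\<^sup>2"
  shows "r * (\<nu> + a * r\<^sup>2) = r * (r + R) * (a * (r - R))"
  by (simp add: assms algebra_simps power2_eq_square)

lemma pitchfork_sign:
  fixes a \<nu> R r :: real
  assumes "\<nu> = - a * R\<^sup>2" "0 \<le> R" "0 < r"
  shows "0 < r * (\<nu> + a * r\<^sup>2) \<longleftrightarrow> 0 < a * (r - R)"
    and "r * (\<nu> + a * r\<^sup>2) < 0 \<longleftrightarrow> a * (r - R) < 0"
proof -
  have "0 < r * (r + R)" using assms by simp
  then show "0 < r * (\<nu> + a * r\<^sup>2) \<longleftrightarrow> 0 < a * (r - R)"
    "r * (\<nu> + a * r\<^sup>2) < 0 \<longleftrightarrow> a * (r - R) < 0"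
    unfolding pitchfork_factor[OF assms(1)]
    by (simp_all only: zero_less_mult_iff mult_less_0_iff) auto
qed

text \<open>
  The field points towards \<open>R\<close> from both sides, and \<open>R\<close> is not crossed, so the distance to \<open>R\<close> does not
  grow.
\<close>

lemma pitchfork_reach_equilibrium:
  fixes a \<nu> R :: real
  assumes a: "a < 0" and R: "0 < R" "\<nu> = - a * R\<^sup>2" and xy: "0 \<le> x" "0 \<le> y"
    and reach: "scalar_reach (\<lambda>r. r * (\<nu> + a * r\<^sup>2)) {0..} x y"
  shows "\<bar>y - R\<bar> \<le> \<bar>x - R\<bar>"
proof -
  let ?f = "\<lambda>r. r * (\<nu> + a * r\<^sup>2)"
  have "x = y \<or> (x < y \<and> (\<forall>z\<in>{x..y}. 0 < ?f z)) \<or> (y < x \<and> (\<forall>z\<in>{y..x}. ?f z < 0))"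
    using reach xy by (subst (asm) scalar_reach_iff[OF C1_field_pitchfork]) (auto simp: is_interval_ci)
  then consider "x = y" | "x < y" "0 < ?f y" | "y < x" "?f y < 0" by fastforce
  then show ?thesis
  proof cases
    case 2
    then have "0 < a * (y - R)" using pitchfork_sign(1)[OF R(2)] R xy by force
    then show ?thesis using a 2 by (simp add: zero_less_mult_iff)
  next
    case 3
    then have "y \<noteq> 0" by auto
    then have "a * (y - R) < 0" using 3 pitchfork_sign(2)[OF R(2)] R xy by force
    then show ?thesis using a 3 by (simp add: mult_less_0_iff)
  qed simp
qed

lemma pitchfork_reach_basin:
  assumes a: "0 < a" and R: "0 < R" "\<nu> = - a * R\<^sup>2" and xy: "0 \<le> x" "x < R" "0 \<le> y"
    and reach: "scalar_reach (\<lambda>r. r * (\<nu> + a * r\<^sup>2)) {0..} x y"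
  shows "y \<le> x"
proof (rule ccontr)
  let ?f = "\<lambda>r. r * (\<nu> + a * r\<^sup>2)"
  assume "\<not> y \<le> x"
  moreover have "x = y \<or> (x < y \<and> (\<forall>z\<in>{x..y}. 0 < ?f z)) \<or> (y < x \<and> (\<forall>z\<in>{y..x}. ?f z < 0))"
    using reach xy by (subst (asm) scalar_reach_iff[OF C1_field_pitchfork]) (auto simp: is_interval_ci)
  ultimately have f: "0 < ?f x" by auto
  then have "0 < x" using xy by (cases "x = 0") auto
  then have "0 < a * (x - R)" using f pitchfork_sign(1)[OF R(2)] R by simp
  then show False using a xy by (simp add: zero_less_mult_iff)
qed

text \<open>
  The substitution \<open>v = 1 / u\<^sup>2\<close> turns the equation into \<open>v' = - 2 \<nu> v - 2 a\<close>. Solving it gives the closed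
  form below, which exists for all positive times as long as the radicand stays positive.
\<close>

lemma pitchfork_solution:
  fixes a \<nu> x :: real
  assumes "\<nu> \<noteq> 0" and "0 \<le> x"
    and D: "\<And>t. 0 \<le> t \<Longrightarrow> 0 < 1 - a * x\<^sup>2 / \<nu> * (exp (2 * \<nu> * t) - 1)"
  shows "\<exists>u. u 0 = x \<and> (\<forall>t\<ge>0. 0 \<le> u t \<and>
    (u has_real_derivative u t * (\<nu> + a * (u t)\<^sup>2)) (at t within {0..}))"
proof -
  define d where "d t = 1 - a * x\<^sup>2 / \<nu> * (exp (2 * \<nu> * t) - 1)" for t
  define u where "u t = x * exp (\<nu> * t) / sqrt (d t)" for t
  have dd: "(d has_real_derivative - 2 * a * x\<^sup>2 * exp (2 * \<nu> * t)) (at t)" for t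
    unfolding d_def using \<open>\<nu> \<noteq> 0\<close> by (auto intro!: derivative_eq_intros)
  have "(u has_real_derivative u t * (\<nu> + a * (u t)\<^sup>2)) (at t)" if "0 \<le> t" for t
  proof -
    have d: "0 < d t" using D[OF that] by (simp add: d_def)
    have e: "exp (2 * \<nu> * t) = (exp (\<nu> * t))\<^sup>2"
      by (simp add: exp_double[symmetric] mult.assoc)
    have s: "sqrt (d t) \<noteq> 0" "(sqrt (d t))\<^sup>2 = d t" using d by auto
    have num: "((\<lambda>t. x * exp (\<nu> * t)) has_real_derivative x * (exp (\<nu> * t) * \<nu>)) (at t)"
      by (auto intro!: derivative_eq_intros)
    have den: "((\<lambda>t. sqrt (d t)) has_real_derivative - (a * x\<^sup>2 * (exp (\<nu> * t))\<^sup>2 / sqrt (d t))) (at t)"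
      using DERIV_chain2[OF DERIV_real_sqrt[OF d] dd[of t, unfolded e]] by (simp add: field_simps)
    have "(u has_real_derivative (x * (exp (\<nu> * t) * \<nu>) * sqrt (d t) -
        x * exp (\<nu> * t) * - (a * x\<^sup>2 * (exp (\<nu> * t))\<^sup>2 / sqrt (d t))) / (sqrt (d t) * sqrt (d t))) (at t)"
      unfolding u_def by (rule DERIV_divide[OF num den s(1)])
    moreover have "(x * (exp (\<nu> * t) * \<nu>) * sqrt (d t) -
        x * exp (\<nu> * t) * - (a * x\<^sup>2 * (exp (\<nu> * t))\<^sup>2 / sqrt (d t))) / (sqrt (d t) * sqrt (d t)) =
        u t * (\<nu> + a * (u t)\<^sup>2)"
      using s(1) by (simp add: u_def field_simps power2_eq_square)
    ultimately show ?thesis by simp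
  qed
  moreover have "u 0 = x" by (simp add: u_def d_def)
  moreover have "0 \<le> u t" if "0 \<le> t" for t
    using D[OF that] \<open>0 \<le> x\<close> by (simp add: u_def d_def)
  ultimately show ?thesis
    by (intro exI[of _ u]) (auto intro: has_field_derivative_at_within)
qed

lemma pitchfork_solution_supercritical:
  fixes a \<nu> x :: real
  assumes "0 < \<nu>" "a < 0" "0 \<le> x"
  shows "\<exists>u. u 0 = x \<and> (\<forall>t\<ge>0. 0 \<le> u t \<and>
    (u has_real_derivative u t * (\<nu> + a * (u t)\<^sup>2)) (at t within {0..}))"
proof (rule pitchfork_solution)
  fix t :: real assume "0 \<le> t"
  have "a * x\<^sup>2 / \<nu> \<le> 0" using assms by (simp add: divide_le_0_iff mult_le_0_iff)
  then have "a * x\<^sup>2 / \<nu> * (exp (2 * \<nu> * t) - 1) \<le> 0"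
    using \<open>0 \<le> t\<close> assms by (intro mult_nonpos_nonneg) auto
  then show "0 < 1 - a * x\<^sup>2 / \<nu> * (exp (2 * \<nu> * t) - 1)" by linarith
qed (use assms in auto)

text \<open>
  By the same substitution, \<open>(1 / u\<^sup>2 + a / \<nu>) exp (2 \<nu> t)\<close> is constant along every positive solution. This
  describes all positive solutions, so the limits below do not require a uniqueness theorem.
\<close>

lemma pitchfork_first_integral:
  fixes a \<nu> :: real
  assumes "\<nu> \<noteq> 0" and "0 < u 0" and nonneg: "\<And>t. 0 \<le> t \<Longrightarrow> 0 \<le> u t"
    and u: "\<And>t. 0 \<le> t \<Longrightarrow> (u has_real_derivative u t * (\<nu> + a * (u t)\<^sup>2)) (at t within {0..})"
    and "0 \<le> t"
  shows "1 / (u t)\<^sup>2 = - a / \<nu> + (1 / (u 0)\<^sup>2 + a / \<nu>) * exp (- 2 * \<nu> * t)"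
proof -
  have pos: "u t \<noteq> 0" if "0 \<le> t" for t
  proof
    assume "u t = 0"
    have "u 0 = 0"
      by (rule constant_at_equilibrium[where u = u and I = "{0..}" and p = 0 and ?t0.0 = t,
            OF C1_field_pitchfork[of \<nu> a]])
         (use u \<open>u t = 0\<close> that in \<open>auto simp: is_interval_ci\<close>)
    then show False using \<open>0 < u 0\<close> by simp
  qed
  define W where "W t = (1 / (u t)\<^sup>2 + a / \<nu>) * exp (2 * \<nu> * t)" for t
  have "(W has_real_derivative 0) (at t within {0..})" if "t \<in> {0..}" for t
  proof -
    have t: "u t \<noteq> 0" "0 \<le> t" using pos that by auto
    let ?v = "u t * (\<nu> + a * (u t)\<^sup>2)"
    have sq: "((\<lambda>t. (u t)\<^sup>2) has_real_derivative 2 * u t * ?v) (at t within {0..})"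
      using DERIV_power[OF u[OF t(2)], of 2] by (simp add: mult_ac)
    have inv: "((\<lambda>t. 1 / (u t)\<^sup>2) has_real_derivative
        (0 * (u t)\<^sup>2 - 1 * (2 * u t * ?v)) / ((u t)\<^sup>2 * (u t)\<^sup>2)) (at t within {0..})"
      by (rule DERIV_divide[OF DERIV_const sq]) (use t in simp)
    have exp: "((\<lambda>t. exp (2 * \<nu> * t)) has_real_derivative exp (2 * \<nu> * t) * (2 * \<nu>)) (at t within {0..})"
      by (auto intro!: derivative_eq_intros)
    have Q: "(0 * (u t)\<^sup>2 - 1 * (2 * u t * ?v)) / ((u t)\<^sup>2 * (u t)\<^sup>2) = - 2 * (\<nu> / (u t)\<^sup>2 + a)"
      using t(1) by (simp add: field_simps power2_eq_square)
    have "((0 * (u t)\<^sup>2 - 1 * (2 * u t * ?v)) / ((u t)\<^sup>2 * (u t)\<^sup>2) + 0) * exp (2 * \<nu> * t) +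
        (exp (2 * \<nu> * t) * (2 * \<nu>)) * (1 / (u t)\<^sup>2 + a / \<nu>) = 0"
      unfolding Q using \<open>\<nu> \<noteq> 0\<close> by (simp add: algebra_simps)
    then show ?thesis
      using DERIV_mult[OF DERIV_add[OF inv DERIV_const[of "a / \<nu>"]] exp] unfolding W_def by simp
  qed
  then obtain K where "\<forall>t\<in>{0..}. W t = K"
    using has_field_derivative_zero_constant[of "{0..}" W] by auto
  then have "W t = W 0" using \<open>0 \<le> t\<close> by simp
  then have "(1 / (u t)\<^sup>2 + a / \<nu>) * (exp (2 * \<nu> * t) * exp (- 2 * \<nu> * t)) =
      (1 / (u 0)\<^sup>2 + a / \<nu>) * exp (- 2 * \<nu> * t)"
    by (simp add: W_def mult.assoc[symmetric])
  then have "1 / (u t)\<^sup>2 + a / \<nu> = (1 / (u 0)\<^sup>2 + a / \<nu>) * exp (- 2 * \<nu> * t)"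
    by (simp flip: exp_add)
  then show ?thesis by simp
qed

lemma pitchfork_limit_equilibrium:
  fixes a \<nu> :: real
  assumes "a < 0" and R: "0 < R" "\<nu> = - a * R\<^sup>2" and u0: "0 < u 0"
    and nonneg: "\<And>t. 0 \<le> t \<Longrightarrow> 0 \<le> u t"
    and u: "\<And>t. 0 \<le> t \<Longrightarrow> (u has_real_derivative u t * (\<nu> + a * (u t)\<^sup>2)) (at t within {0..})"
  shows "(u \<longlongrightarrow> R) at_top"
proof -
  have \<nu>: "0 < \<nu>" "\<nu> \<noteq> 0" using \<open>a < 0\<close> R by (auto simp: mult_neg_pos)
  define K where "K = 1 / (u 0)\<^sup>2 + a / \<nu>"
  have eq: "sqrt (1 / (- a / \<nu> + K * exp (- 2 * \<nu> * t))) = u t" if "0 \<le> t" for t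
    using pitchfork_first_integral[OF \<nu>(2) u0 nonneg u that, symmetric] nonneg[OF that]
    by (simp add: K_def)
  have "LIM t at_top. - 2 * \<nu> * t :> at_bot"
    by (rule filterlim_tendsto_neg_mult_at_bot[OF tendsto_const _ filterlim_ident]) (use \<nu>(1) in simp)
  then have "((\<lambda>t. exp (- 2 * \<nu> * t)) \<longlongrightarrow> 0) at_top"
    by (rule filterlim_compose[OF exp_at_bot])
  moreover have aR: "- a / \<nu> = 1 / R\<^sup>2" using R \<open>a < 0\<close> by simp
  ultimately have "((\<lambda>t. sqrt (1 / (- a / \<nu> + K * exp (- 2 * \<nu> * t)))) \<longlongrightarrow> sqrt (1 / (- a / \<nu> + K * 0))) at_top"
    using R by (intro tendsto_intros) auto
  moreover have "sqrt (1 / (- a / \<nu> + K * 0)) = R" unfolding aR using R by simp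
  ultimately show ?thesis
    using eq by (auto intro: Lim_transform_eventually eventually_mono[OF eventually_ge_at_top[of 0]])
qed

lemma pitchfork_limit_zero:
  fixes a \<nu> :: real
  assumes "0 < a" and R: "0 < R" "\<nu> = - a * R\<^sup>2" and u0: "u 0 < R"
    and nonneg: "\<And>t. 0 \<le> t \<Longrightarrow> 0 \<le> u t"
    and u: "\<And>t. 0 \<le> t \<Longrightarrow> (u has_real_derivative u t * (\<nu> + a * (u t)\<^sup>2)) (at t within {0..})"
  shows "(u \<longlongrightarrow> 0) at_top"
proof (cases "u 0 = 0")
  case True
  have "u t = 0" if "0 \<le> t" for t
    by (rule constant_at_equilibrium[where u = u and I = "{0..}" and p = 0 and ?t0.0 = 0,
          OF C1_field_pitchfork[of \<nu> a]])
       (use u True that in \<open>auto simp: is_interval_ci\<close>)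
  then show ?thesis
    by (intro tendsto_eventually eventually_mono[OF eventually_ge_at_top[of 0]]) auto
next
  case False
  then have pos: "0 < u 0" using nonneg[of 0] by simp
  have \<nu>: "\<nu> < 0" "\<nu> \<noteq> 0" using \<open>0 < a\<close> R by auto
  define K where "K = 1 / (u 0)\<^sup>2 + a / \<nu>"
  have "a / \<nu> = - 1 / R\<^sup>2" using R \<open>0 < a\<close> by simp
  moreover have "1 / R\<^sup>2 < 1 / (u 0)\<^sup>2"
    using pos u0 by (intro divide_strict_left_mono power_strict_mono) auto
  ultimately have K: "0 < K" by (simp add: K_def)
  have eq: "sqrt (inverse (- a / \<nu> + K * exp (- 2 * \<nu> * t))) = u t" if "0 \<le> t" for t
    using pitchfork_first_integral[OF \<nu>(2) pos nonneg u that, symmetric] nonneg[OF that]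
    by (simp add: K_def inverse_eq_divide)
  have "LIM t at_top. - 2 * \<nu> * t :> at_top"
    by (rule filterlim_tendsto_pos_mult_at_top[OF tendsto_const _ filterlim_ident]) (use \<nu>(1) in simp)
  then have "LIM t at_top. exp (- 2 * \<nu> * t) :> at_top"
    by (rule filterlim_compose[OF exp_at_top])
  then have "LIM t at_top. - a / \<nu> + K * exp (- 2 * \<nu> * t) :> at_top"
    by (intro filterlim_tendsto_add_at_top[OF tendsto_const]
        filterlim_tendsto_pos_mult_at_top[OF tendsto_const K])
  then have "((\<lambda>t. sqrt (inverse (- a / \<nu> + K * exp (- 2 * \<nu> * t)))) \<longlongrightarrow> sqrt 0) at_top"
    by (intro tendsto_real_sqrt tendsto_inverse_0_at_top)
  then show ?thesis
    using eq by (auto intro: Lim_transform_eventually eventually_mono[OF eventually_ge_at_top[of 0]])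
qed

section \<open>Bifurcation and stability of the invariant torus\<close>

context leaf_geometry
begin

lemma invariant_tori_pitchfork:
  assumes "a \<noteq> 0"
  shows "invariant_tori n k \<sigma> c 1 (coeffs1 a \<nu>) =
    (if \<nu> * a < 0 then {shell (sqrt (- \<nu> / a))} else {})"
proof -
  have zero: "0 < r \<and> r * (\<nu> + a * r\<^sup>2) = 0 \<longleftrightarrow> \<nu> * a < 0 \<and> r = sqrt (- \<nu> / a)" for r
  proof
    assume r: "0 < r \<and> r * (\<nu> + a * r\<^sup>2) = 0"
    then have "\<nu> + a * r\<^sup>2 = 0" by auto
    then have "\<nu> = - (a * r\<^sup>2)" by linarith
    moreover have "0 < a * a" using assms by (simp add: zero_less_mult_iff) linarith
    ultimately show "\<nu> * a < 0 \<and> r = sqrt (- \<nu> / a)"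
      using r assms by (simp add: mult_less_0_iff zero_less_mult_iff)
  next
    assume *: "\<nu> * a < 0 \<and> r = sqrt (- \<nu> / a)"
    then have "0 < - \<nu> / a" by (auto simp: mult_less_0_iff divide_pos_neg divide_neg_pos)
    then show "0 < r \<and> r * (\<nu> + a * r\<^sup>2) = 0" using * assms by simp
  qed
  then have "invariant_tori n k \<sigma> c 1 (coeffs1 a \<nu>) =
      {hypertorus n k \<sigma> c r | r. 0 < r \<and> \<nu> * a < 0 \<and> r = sqrt (- \<nu> / a)}"
    unfolding invariant_tori_def amplitude_coeffs1 by metis
  moreover have "0 < sqrt (- \<nu> / a)" if "\<nu> * a < 0"
    using that by (auto simp: mult_less_0_iff divide_pos_neg divide_neg_pos)
  ultimately show ?thesis using hypertorus_eq_shell by auto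
qed

lemma pitchfork_torus_asymptotically_stable:
  assumes "0 < \<nu>" "a < 0"
  shows "asymptotically_stable (closed_leaf n k \<sigma> c)
    (leaf_normal_form n k \<sigma> c 1 (coeffs1 a \<nu>) \<omega> b) (shell (sqrt (- \<nu> / a)))"
proof -
  define R where "R = sqrt (- \<nu> / a)"
  have R: "0 < R" "\<nu> = - a * R\<^sup>2"
    using assms by (auto simp: R_def zero_less_divide_iff divide_nonneg_neg field_simps)
  have "lyapunov_stable (leaf_normal_form n k \<sigma> c 1 (coeffs1 a \<nu>) \<omega> b) (shell R)"
    by (rule shell_lyapunov_stable, unfold amplitude_coeffs1)
       (metis pitchfork_reach_equilibrium[OF assms(2) R] order.strict_trans1)
  moreover have "attracting (closed_leaf n k \<sigma> c) (leaf_normal_form n k \<sigma> c 1 (coeffs1 a \<nu>) \<omega> b) (shell R)"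
  proof (rule shell_attracting[OF R(1)], unfold amplitude_coeffs1)
    fix x assume x: "0 \<le> x" "\<bar>x - R\<bar> < R"
    show "\<exists>u. u 0 = x \<and> (\<forall>t\<ge>0. 0 \<le> u t \<and>
        (u has_real_derivative u t * (\<nu> + a * (u t)\<^sup>2)) (at t within {0..}))"
      by (rule pitchfork_solution_supercritical[OF assms x(1)])
  next
    fix u assume u: "\<bar>u 0 - R\<bar> < R" "\<And>t. 0 \<le> t \<Longrightarrow> 0 \<le> u t"
      "\<And>t. 0 \<le> t \<Longrightarrow> (u has_real_derivative u t * (\<nu> + a * (u t)\<^sup>2)) (at t within {0..})"
    have "0 < u 0" using u(1) by linarith
    then show "(u \<longlongrightarrow> R) at_top"
      using pitchfork_limit_equilibrium[OF assms(2) R] u by blast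
  qed
  ultimately show ?thesis by (simp add: asymptotically_stable_def R_def)
qed

text \<open>
  Every solution that starts at a small positive radius tends to \<open>R\<close> and hence leaves the neighbourhood
  \<open>\<rho> < R / 2\<close> of the origin.
\<close>

lemma pitchfork_origin_unstable:
  assumes "0 < \<nu>" "a < 0"
  shows "\<not> lyapunov_stable (leaf_normal_form n k \<sigma> c 1 (coeffs1 a \<nu>) \<omega> b) {origin}"
proof
  let ?sol = "leaf_normal_form n k \<sigma> c 1 (coeffs1 a \<nu>) \<omega> b"
  assume stable: "lyapunov_stable ?sol {origin}"
  define R where "R = sqrt (- \<nu> / a)"
  have R: "0 < R" "\<nu> = - a * R\<^sup>2"
    using assms by (auto simp: R_def zero_less_divide_iff divide_nonneg_neg field_simps)
  let ?U = "{z :: state. norm (z (\<sigma> k)) \<in> {..<R / 2}}"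
  have "open ?U" by (rule open_radius_vimage) simp
  moreover have "{origin} \<subseteq> ?U" using R by (simp add: origin_def)
  ultimately obtain V where V: "open V" "{origin} \<subseteq> V"
    "\<And>T z. 0 \<le> T \<Longrightarrow> ?sol {0..T} z \<Longrightarrow> z 0 \<in> V \<Longrightarrow> z T \<in> ?U"
    using stable unfolding lyapunov_stable_def by meson
  obtain \<eta> where \<eta>: "0 < \<eta>" "\<And>r. 0 \<le> r \<Longrightarrow> \<bar>r - 0\<bar> < \<eta> \<Longrightarrow> shell r \<subseteq> V"
    using shell_nearby[of V 0] V by (auto simp: shell_0)
  define x where "x = \<eta> / 2"
  have x: "0 < x" "shell x \<subseteq> V" using \<eta> by (auto simp: x_def)
  obtain p where p: "p \<in> shell x" using shell_nonempty[of x] x by auto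
  obtain u where u: "u 0 = x" "\<And>t. 0 \<le> t \<Longrightarrow> 0 \<le> u t"
      "\<And>t. 0 \<le> t \<Longrightarrow> (u has_real_derivative u t * (\<nu> + a * (u t)\<^sup>2)) (at t within {0..})"
    using pitchfork_solution_supercritical[OF assms, of x] x by auto
  obtain z where z: "?sol {0..} z" "z 0 = p" "\<And>t. t \<in> {0..} \<Longrightarrow> norm (z t (\<sigma> k)) = u t"
    using normal_form_lift[of "{0..}" p u 1 "coeffs1 a \<nu>" \<omega> b] u p
    by (auto simp: is_interval_ci amplitude_coeffs1 simp del: One_nat_def)
  have "u t < R / 2" if "0 \<le> t" for t
  proof -
    have "?sol {0..t} z" by (rule normal_form_subset[OF z(1)]) auto
    then have "z t \<in> ?U" using V(3)[OF that] p x(2) z(2) by blast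
    then show ?thesis using z(3) that by simp
  qed
  moreover have "(u \<longlongrightarrow> R) at_top"
    by (rule pitchfork_limit_equilibrium[OF assms(2) R]) (use u x in auto)
  then have "\<forall>\<^sub>F t in at_top. R / 2 < u t"
    by (rule order_tendstoD) (use R in simp)
  then have "\<forall>\<^sub>F t in at_top. R / 2 < u t \<and> 0 \<le> t"
    using eventually_ge_at_top[of 0] by (rule eventually_conj)
  then obtain t where "R / 2 < u t" "0 \<le> t"
    by (auto simp: eventually_at_top_linorder)
  ultimately show False by fastforce
qed

lemma pitchfork_origin_asymptotically_stable:
  assumes "\<nu> < 0" "0 < a"
  shows "asymptotically_stable (closed_leaf n k \<sigma> c)
    (leaf_normal_form n k \<sigma> c 1 (coeffs1 a \<nu>) \<omega> b) {origin}"
proof -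
  define R where "R = sqrt (- \<nu> / a)"
  have R: "0 < R" "\<nu> = - a * R\<^sup>2"
    using assms by (auto simp: R_def zero_less_divide_iff divide_nonpos_pos field_simps)
  have "lyapunov_stable (leaf_normal_form n k \<sigma> c 1 (coeffs1 a \<nu>) \<omega> b) (shell 0)"
  proof (rule shell_lyapunov_stable, unfold amplitude_coeffs1)
    fix \<eta> :: real assume "0 < \<eta>"
    have "\<bar>y - 0\<bar> < \<eta>" if "0 \<le> x" "0 \<le> y" "\<bar>x - 0\<bar> < min \<eta> R"
      "scalar_reach (\<lambda>r. r * (\<nu> + a * r\<^sup>2)) {0..} x y" for x y
      using pitchfork_reach_basin[OF assms(2) R, of x y] that by auto
    moreover have "0 < min \<eta> R" using \<open>0 < \<eta>\<close> R(1) by simp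
    ultimately show "\<exists>\<delta>>0. \<forall>x\<ge>0. \<forall>y\<ge>0. \<bar>x - 0\<bar> < \<delta> \<longrightarrow>
        scalar_reach (\<lambda>r. r * (\<nu> + a * r\<^sup>2)) {0..} x y \<longrightarrow> \<bar>y - 0\<bar> < \<eta>"
      by blast
  qed
  moreover have "attracting (closed_leaf n k \<sigma> c) (leaf_normal_form n k \<sigma> c 1 (coeffs1 a \<nu>) \<omega> b) (shell 0)"
  proof (rule shell_attracting[OF R(1)], unfold amplitude_coeffs1)
    fix x assume x: "0 \<le> x" "\<bar>x - 0\<bar> < R"
    have "0 < 1 - a * x\<^sup>2 / \<nu> * (exp (2 * \<nu> * t) - 1)" if "0 \<le> t" for t
    proof -
      have q: "- (a * x\<^sup>2 / \<nu>) = (x / R)\<^sup>2"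
        using assms R by (simp add: power_divide)
      have "(x / R)\<^sup>2 < 1" using x R by (simp add: power_less_one_iff abs_square_less_1)
      moreover have "0 < exp (2 * \<nu> * t)" "exp (2 * \<nu> * t) \<le> 1"
        using that assms by (auto simp: mult_nonpos_nonneg)
      ultimately have "(x / R)\<^sup>2 * (1 - exp (2 * \<nu> * t)) \<le> (x / R)\<^sup>2 * 1"
        by (intro mult_left_mono) auto
      then have "(x / R)\<^sup>2 * (1 - exp (2 * \<nu> * t)) < 1" using \<open>(x / R)\<^sup>2 < 1\<close> by linarith
      then show ?thesis unfolding q[symmetric] by (simp add: algebra_simps)
    qed
    then show "\<exists>u. u 0 = x \<and> (\<forall>t\<ge>0. 0 \<le> u t \<and>
        (u has_real_derivative u t * (\<nu> + a * (u t)\<^sup>2)) (at t within {0..}))"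
      using x assms by (intro pitchfork_solution) auto
  next
    fix u assume u: "\<bar>u 0 - 0\<bar> < R" "\<And>t. 0 \<le> t \<Longrightarrow> 0 \<le> u t"
      "\<And>t. 0 \<le> t \<Longrightarrow> (u has_real_derivative u t * (\<nu> + a * (u t)\<^sup>2)) (at t within {0..})"
    have "u 0 < R" using u(1) by linarith
    then show "(u \<longlongrightarrow> 0) at_top"
      using pitchfork_limit_zero[OF assms(2) R] u by blast
  qed
  ultimately show ?thesis by (simp add: asymptotically_stable_def shell_0)
qed

lemma pitchfork_torus_repelling:
  assumes "\<nu> < 0" "0 < a"
  shows "repelling (closed_leaf n k \<sigma> c)
    (leaf_normal_form n k \<sigma> c 1 (coeffs1 a \<nu>) \<omega> b) (shell (sqrt (- \<nu> / a)))"
proof -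
  have "(\<lambda>j. - coeffs1 a \<nu> j) = coeffs1 (- a) (- \<nu>)"
    by (simp add: coeffs1_def fun_eq_iff)
  then show ?thesis
    using pitchfork_torus_asymptotically_stable[of "- \<nu>" "- a" "\<lambda>i. - \<omega> i" "\<lambda>i j. - b i j"] assms
    by (simp add: repelling_def time_reversal_normal_form)
qed

text \<open>
  The dilation by \<open>l = \<surd>(\<nu>' / \<nu>)\<close> multiplies the field at corresponding points by the positive factor
  \<open>l\<^sup>3\<close>, so it preserves signs. Hence it relates the systems even when their phase equations differ.
\<close>

lemma leaf_equivalent_same_sign:
  assumes "0 < \<nu> * \<nu>'"
  shows "leaf_equivalent n k \<sigma> c (leaf_normal_form n k \<sigma> c 1 (coeffs1 a \<nu>) \<omega> b)
    (leaf_normal_form n k \<sigma> c 1 (coeffs1 a \<nu>') \<omega>' b')"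
proof -
  have q: "0 < \<nu>' / \<nu>" and "\<nu> \<noteq> 0" using assms by (auto simp: zero_less_mult_iff zero_less_divide_iff)
  define l where "l = sqrt (\<nu>' / \<nu>)"
  have l: "0 < l" "l\<^sup>2 = \<nu>' / \<nu>" using q by (auto simp: l_def)
  define h :: "real \<Rightarrow> state \<Rightarrow> state" where "h s z = (\<lambda>i. s *\<^sub>R z i)" for s z
  have "continuous_on S (h s)" for s S
    unfolding h_def
    by (intro continuous_on_coordinatewise_then_product continuous_intros
        continuous_on_subset[OF continuous_on_product_coordinates subset_UNIV])
  then have "homeomorphism (closed_leaf n k \<sigma> c) (closed_leaf n k \<sigma> c) (h l) (h (1 / l))"
    using l(1) closed_leaf_scale by (intro homeomorphismI) (auto simp: h_def)
  moreover have "torus_reach k \<sigma> (leaf_normal_form n k \<sigma> c 1 (coeffs1 a \<nu>) \<omega> b) p q \<longleftrightarrow>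
      torus_reach k \<sigma> (leaf_normal_form n k \<sigma> c 1 (coeffs1 a \<nu>') \<omega>' b') (h l p) (h l q)"
    if "p \<in> closed_leaf n k \<sigma> c" for p q
  proof -
    have "h l p \<in> closed_leaf n k \<sigma> c"
      using closed_leaf_scale that l(1) by (simp add: h_def)
    moreover have "norm (h l z (\<sigma> k)) = l * norm (z (\<sigma> k))" for z
      using l(1) by (simp add: h_def)
    moreover have "scalar_reach (\<lambda>r. r * (\<nu> + a * r\<^sup>2)) {0..} x y \<longleftrightarrow>
        scalar_reach (\<lambda>r. r * (\<nu>' + a * r\<^sup>2)) {0..} (l * x) (l * y)" if "0 \<le> x" "0 \<le> y" for x y
    proof (rule scalar_reach_conjugate[OF C1_field_pitchfork C1_field_pitchfork])
      show "bij_betw ((*) l) {0..} {0..}"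
        by (rule bij_betw_byWitness[where f' = "\<lambda>x. x / l"]) (use l(1) in auto)
      show "strict_mono_on {0..} ((*) l)"
        by (rule strict_mono_onI) (use l(1) in simp)
      fix x :: real
      have "\<nu>' = \<nu> * l\<^sup>2" using l(2) \<open>\<nu> \<noteq> 0\<close> by simp
      then have "l * x * (\<nu>' + a * (l * x)\<^sup>2) = l ^ 3 * (x * (\<nu> + a * x\<^sup>2))"
        by (simp add: algebra_simps power2_eq_square power3_eq_cube)
      then show "sgn (x * (\<nu> + a * x\<^sup>2)) = sgn (l * x * (\<nu>' + a * (l * x)\<^sup>2))"
        unfolding \<open>l * x * (\<nu>' + a * (l * x)\<^sup>2) = _\<close> using l(1) by (simp add: sgn_mult)
    qed (use that in \<open>auto simp: is_interval_ci\<close>)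
    ultimately show ?thesis
      using that by (simp add: torus_reach_iff amplitude_coeffs1 del: One_nat_def)
  qed
  ultimately show ?thesis unfolding leaf_equivalent_def by blast
qed

text \<open>
  An equivalence is a bijection of the closed leaf that preserves whether one of two points reaches the
  hypertorus of the other. At \<open>\<nu> = 0\<close> this holds for any two points other than the origin. With an
  invariant torus of radius \<open>R\<close> it fails for every two of three points with the radii \<open>R / 2\<close>, \<open>R\<close> and
  \<open>2 R\<close>, and at least two of these correspond to points other than the origin.
\<close>

lemma not_leaf_equivalent_at_zero:
  assumes "a \<noteq> 0" "\<nu> * a < 0"
  shows "\<not> leaf_equivalent n k \<sigma> c (leaf_normal_form n k \<sigma> c 1 (coeffs1 a 0) \<omega> b)
    (leaf_normal_form n k \<sigma> c 1 (coeffs1 a \<nu>) \<omega>' b')"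
proof
  let ?X = "closed_leaf n k \<sigma> c"
  let ?cubic = "leaf_normal_form n k \<sigma> c 1 (coeffs1 a 0) \<omega> b"
  let ?sol = "leaf_normal_form n k \<sigma> c 1 (coeffs1 a \<nu>) \<omega>' b'"
  assume "leaf_equivalent n k \<sigma> c ?cubic ?sol"
  then obtain h h' where hom: "homeomorphism ?X ?X h h'"
    and reach: "\<And>p q. p \<in> ?X \<Longrightarrow> q \<in> ?X \<Longrightarrow>
      torus_reach k \<sigma> ?cubic p q \<longleftrightarrow> torus_reach k \<sigma> ?sol (h p) (h q)"
    unfolding leaf_equivalent_def by blast
  define R where "R = sqrt (- \<nu> / a)"
  have "0 < - \<nu> / a" using assms by (auto simp: mult_less_0_iff divide_pos_neg divide_neg_pos)
  then have R: "0 < R" "R * (\<nu> + a * R\<^sup>2) = 0" using assms by (auto simp: R_def)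
  have comparable: "torus_reach k \<sigma> ?cubic p q \<or> torus_reach k \<sigma> ?cubic q p"
    if pq: "p \<in> ?X" "q \<in> ?X" "p \<noteq> origin" "q \<noteq> origin" for p q
  proof -
    have pos: "0 < norm (z (\<sigma> k))" if "z \<in> ?X" "z \<noteq> origin" for z
      using that closed_leaf_iff[of z] shell_0 by (cases "z (\<sigma> k) = 0") auto
    have "scalar_reach (\<lambda>r. r * (0 + a * r\<^sup>2)) {0..} x y \<or> scalar_reach (\<lambda>r. r * (0 + a * r\<^sup>2)) {0..} y x"
      if "0 < x" "0 < y" for x y
    proof -
      have iff: "scalar_reach (\<lambda>r. r * (0 + a * r\<^sup>2)) {0..} x y \<longleftrightarrow> x = y \<or>
          (x < y \<and> (\<forall>z\<in>{x..y}. 0 < z * (0 + a * z\<^sup>2))) \<or>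
          (y < x \<and> (\<forall>z\<in>{y..x}. z * (0 + a * z\<^sup>2) < 0))" if "0 < x" "0 < y" for x y
        using that by (intro scalar_reach_iff[OF C1_field_pitchfork]) (auto simp: is_interval_ci)
      show ?thesis
        unfolding iff[OF that] iff[OF that(2,1)] using that assms(1)
        by (cases x y rule: linorder_cases; cases "0 < a")
           (auto simp: zero_less_mult_iff mult_less_0_iff)
    qed
    from this[OF pos[OF pq(1,3)] pos[OF pq(2,4)]] show ?thesis
      by (simp only: torus_reach_iff[OF pq(1)] torus_reach_iff[OF pq(2)] amplitude_coeffs1)
  qed
  have incomparable: "\<not> torus_reach k \<sigma> ?sol p q"
    if "p \<in> shell x" "q \<in> shell y" "x \<noteq> y" "min x y \<le> R" "R \<le> max x y" "0 \<le> x" "0 \<le> y" for p q x y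
    using that equilibrium_not_crossed[OF C1_field_pitchfork[of \<nu> a], of "{0..}" x y R] R(2)
      shell_subset_closed_leaf[OF that(1)] norm_shell[OF that(1)] norm_shell[OF that(2)]
    by (auto simp: torus_reach_iff amplitude_coeffs1 is_interval_ci simp del: One_nat_def)
  have preimage: "h' p \<in> ?X \<and> h (h' p) = p" if "p \<in> shell x" for p x
    using hom shell_subset_closed_leaf[OF that] by (auto simp: homeomorphism_def)
  obtain p1 p2 p3 where p: "p1 \<in> shell (R / 2)" "p2 \<in> shell R" "p3 \<in> shell (2 * R)"
    using shell_nonempty[of "R / 2"] shell_nonempty[of R] shell_nonempty[of "2 * R"] R(1)
    by (metis divide_nonneg_pos less_imp_le mult_nonneg_nonneg zero_le_numeral zero_less_numeral)
  have no: "\<not> torus_reach k \<sigma> ?sol p1 p2" "\<not> torus_reach k \<sigma> ?sol p2 p1"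
    "\<not> torus_reach k \<sigma> ?sol p1 p3" "\<not> torus_reach k \<sigma> ?sol p3 p1"
    "\<not> torus_reach k \<sigma> ?sol p2 p3" "\<not> torus_reach k \<sigma> ?sol p3 p2"
    using incomparable[OF p(1) p(2)] incomparable[OF p(2) p(1)] incomparable[OF p(1) p(3)]
      incomparable[OF p(3) p(1)] incomparable[OF p(2) p(3)] incomparable[OF p(3) p(2)] R(1)
    by simp_all
  have "p1 \<noteq> p2" "p1 \<noteq> p3" "p2 \<noteq> p3"
    using p[THEN norm_shell] R(1) by auto
  then have "h' p1 \<noteq> h' p2" "h' p1 \<noteq> h' p3" "h' p2 \<noteq> h' p3"
    using p[THEN preimage] by metis+
  then consider "h' p1 \<noteq> origin" "h' p2 \<noteq> origin" | "h' p1 \<noteq> origin" "h' p3 \<noteq> origin"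
    | "h' p2 \<noteq> origin" "h' p3 \<noteq> origin"
    by metis
  then show False
    using comparable reach no p[THEN preimage] by cases metis+
qed

lemma pitchfork_bifurcation_variety:
  assumes "a \<noteq> 0"
  shows "leaf_bifurcation_variety n k \<sigma> c
    (\<lambda>\<nu>. leaf_normal_form n k \<sigma> c 1 (coeffs1 a \<nu>) \<omega> (b \<nu>)) = {\<nu>. \<nu> = 0}"
proof -
  let ?sol = "\<lambda>\<nu>. leaf_normal_form n k \<sigma> c 1 (coeffs1 a \<nu>) \<omega> (b \<nu>)"
  have "\<exists>\<nu>'. dist \<nu>' 0 < \<epsilon> \<and> \<not> leaf_equivalent n k \<sigma> c (?sol 0) (?sol \<nu>')" if "0 < \<epsilon>" for \<epsilon>
  proof (intro exI conjI)
    show "dist (- sgn a * (\<epsilon> / 2)) 0 < \<epsilon>"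
      using that assms by (simp add: dist_real_def abs_mult abs_sgn_eq)
    have "- sgn a * (\<epsilon> / 2) * a < 0"
      using that assms by (auto simp: sgn_if mult_less_0_iff)
    then show "\<not> leaf_equivalent n k \<sigma> c (?sol 0) (?sol (- sgn a * (\<epsilon> / 2)))"
      using not_leaf_equivalent_at_zero[OF assms] by blast
  qed
  moreover have "\<exists>\<epsilon>>0. \<forall>\<nu>'. dist \<nu>' \<nu> < \<epsilon> \<longrightarrow> leaf_equivalent n k \<sigma> c (?sol \<nu>) (?sol \<nu>')"
    if "\<nu> \<noteq> 0" for \<nu>
  proof (intro exI[of _ "\<bar>\<nu>\<bar>"] conjI allI impI leaf_equivalent_same_sign)
    fix \<nu>' assume "dist \<nu>' \<nu> < \<bar>\<nu>\<bar>"
    then show "0 < \<nu> * \<nu>'"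
      using that by (auto simp: dist_real_def zero_less_mult_iff abs_if split: if_splits)
  qed (use that in simp)
  ultimately have "(\<forall>\<epsilon>>0. \<exists>\<nu>'. dist \<nu>' \<nu> < \<epsilon> \<and> \<not> leaf_equivalent n k \<sigma> c (?sol \<nu>) (?sol \<nu>')) \<longleftrightarrow> \<nu> = 0" for \<nu>
    by blast
  then show ?thesis
    unfolding leaf_bifurcation_variety_def by simp
qed

lemma pitchfork_torus_bifurcation:
  assumes "a \<noteq> 0"
  shows "torus_bifurcation_from_origin (\<lambda>\<nu>. invariant_tori n k \<sigma> c 1 (coeffs1 a \<nu>))
    (\<lambda>\<nu>. leaf_normal_form n k \<sigma> c 1 (coeffs1 a \<nu>) \<omega> (b \<nu>))"
proof -
  \<comment> \<open>The half-line of parameters with an invariant torus: positive for \<open>a < 0\<close>, negative for \<open>a > 0\<close>.\<close>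
  define S where "S = {\<nu>. \<nu> * a < 0}"
  define T where "T \<nu> = shell (sqrt (- \<nu> / a))" for \<nu>
  have S: "S = {0<..} \<or> S = {..<0}"
    using assms by (cases "0 < a") (auto simp: S_def mult_less_0_iff)
  have quot: "0 < - \<nu> / a" if "\<nu> \<in> S" for \<nu>
    using that by (auto simp: S_def mult_less_0_iff divide_pos_neg divide_neg_pos)
  have "flow_invariant (leaf_normal_form n k \<sigma> c 1 (coeffs1 a \<nu>) \<omega> (b \<nu>)) (T \<nu>)" if "\<nu> \<in> S" for \<nu>
    unfolding T_def
    by (rule shell_flow_invariant, unfold amplitude_coeffs1, rule C1_field_pitchfork)
       (use quot[OF that] assms in simp)
  moreover have "\<forall>\<^sub>F \<nu> in at 0 within S. T \<nu> \<subseteq> U" if U: "open U" "origin \<in> U" for U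
  proof -
    obtain \<eta> where \<eta>: "0 < \<eta>" "\<And>r. 0 \<le> r \<Longrightarrow> \<bar>r - 0\<bar> < \<eta> \<Longrightarrow> shell r \<subseteq> U"
      using shell_nearby[of U 0] U by (auto simp: shell_0)
    have "((\<lambda>\<nu>. sqrt (- \<nu> / a)) \<longlongrightarrow> sqrt (- 0 / a)) (at 0 within S)"
      using assms by (intro tendsto_intros)
    then have "\<forall>\<^sub>F \<nu> in at 0 within S. dist (sqrt (- \<nu> / a)) 0 < \<eta>"
      using \<eta>(1) tendstoD by fastforce
    moreover have "\<forall>\<^sub>F \<nu> in at 0 within S. \<nu> \<in> S"
      by (simp add: eventually_at_filter)
    ultimately show ?thesis
    proof eventually_elim
      case (elim \<nu>)
      then show ?case
        using \<eta>(2)[of "sqrt (- \<nu> / a)"] quot[of \<nu>] by (simp add: T_def dist_real_def)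
    qed
  qed
  ultimately show ?thesis
    unfolding torus_bifurcation_from_origin_def invariant_tori_pitchfork[OF assms]
    using S by (intro exI[of _ S] exI[of _ T]) (auto simp: S_def T_def)
qed

end

theorem theorem5p1:
  fixes n k :: nat and \<sigma> :: "nat \<Rightarrow> nat" and C \<omega> :: "nat \<Rightarrow> real"
    and a1 :: real and b :: "nat \<Rightarrow> nat \<Rightarrow> real \<Rightarrow> real"
  assumes "2 \<le> k" and "k \<le> n"
    and "\<sigma> \<in> shuffle_perms n k"
    and "C \<in> pos_sphere n k \<sigma>"
    and "a1 \<noteq> 0"
    and "\<forall>i\<in>{1..n}. \<omega> i \<noteq> 0"
    and "\<forall>i\<in>{1..n}. \<forall>j\<in>{1..n}. i < j \<longrightarrow> \<omega> i / \<omega> j \<notin> \<rat>"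
    and "\<forall>i\<in>{1..k}. b i 0 0 = 0"
  shows "torus_bifurcation_from_origin
           (\<lambda>\<nu>0. invariant_tori n k \<sigma> C 1 (coeffs1 a1 \<nu>0))
           (leaf_normal_form1 n k \<sigma> C a1 \<omega> b) \<and>
         determined 3 (\<lambda>\<nu>0. amplitude 1 (coeffs1 a1 \<nu>0)) \<and>
         leaf_bifurcation_variety n k \<sigma> C (leaf_normal_form1 n k \<sigma> C a1 \<omega> b) = {\<nu>0. \<nu>0 = 0} \<and>
         (\<forall>\<nu>0. \<nu>0 > 0 \<and> a1 < 0 \<longrightarrow>
            (\<exists>T. invariant_tori n k \<sigma> C 1 (coeffs1 a1 \<nu>0) = {T} \<and>
               asymptotically_stable (closed_leaf n k \<sigma> C) (leaf_normal_form1 n k \<sigma> C a1 \<omega> b \<nu>0) T \<and>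
               \<not> lyapunov_stable (leaf_normal_form1 n k \<sigma> C a1 \<omega> b \<nu>0) {origin})) \<and>
         (\<forall>\<nu>0. a1 > 0 \<and> \<nu>0 < 0 \<longrightarrow>
            (\<exists>T. invariant_tori n k \<sigma> C 1 (coeffs1 a1 \<nu>0) = {T} \<and>
               asymptotically_stable (closed_leaf n k \<sigma> C) (leaf_normal_form1 n k \<sigma> C a1 \<omega> b \<nu>0) {origin} \<and>
               repelling (closed_leaf n k \<sigma> C) (leaf_normal_form1 n k \<sigma> C a1 \<omega> b \<nu>0) T))"
proof -
  interpret leaf_geometry n k \<sigma> C
    using assms by unfold_locales auto
  have sol: "leaf_normal_form1 n k \<sigma> C a1 \<omega> b =
      (\<lambda>\<nu>. leaf_normal_form n k \<sigma> C 1 (coeffs1 a1 \<nu>) \<omega> (\<lambda>i j. b i j \<nu>))"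
    by (simp add: leaf_normal_form1_def fun_eq_iff)
  show ?thesis
    unfolding sol
  proof (intro conjI allI impI; (elim conjE)?)
    show "torus_bifurcation_from_origin (\<lambda>\<nu>0. invariant_tori n k \<sigma> C 1 (coeffs1 a1 \<nu>0))
        (\<lambda>\<nu>. leaf_normal_form n k \<sigma> C 1 (coeffs1 a1 \<nu>) \<omega> (\<lambda>i j. b i j \<nu>))"
      by (rule pitchfork_torus_bifurcation[OF \<open>a1 \<noteq> 0\<close>])
    show "determined 3 (\<lambda>\<nu>0. amplitude 1 (coeffs1 a1 \<nu>0))"
      unfolding amplitude_coeffs1 by (rule pitchfork_three_determined[OF \<open>a1 \<noteq> 0\<close>])
    show "leaf_bifurcation_variety n k \<sigma> C
        (\<lambda>\<nu>. leaf_normal_form n k \<sigma> C 1 (coeffs1 a1 \<nu>) \<omega> (\<lambda>i j. b i j \<nu>)) = {\<nu>0. \<nu>0 = 0}"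
      by (rule pitchfork_bifurcation_variety[OF \<open>a1 \<noteq> 0\<close>])
  next
    fix \<nu> :: real assume \<nu>: "0 < \<nu>" "a1 < 0"
    then show "\<exists>T. invariant_tori n k \<sigma> C 1 (coeffs1 a1 \<nu>) = {T} \<and>
        asymptotically_stable (closed_leaf n k \<sigma> C)
          (leaf_normal_form n k \<sigma> C 1 (coeffs1 a1 \<nu>) \<omega> (\<lambda>i j. b i j \<nu>)) T \<and>
        \<not> lyapunov_stable (leaf_normal_form n k \<sigma> C 1 (coeffs1 a1 \<nu>) \<omega> (\<lambda>i j. b i j \<nu>)) {origin}"
      using pitchfork_torus_asymptotically_stable[OF \<nu>] pitchfork_origin_unstable[OF \<nu>]
      by (auto simp: invariant_tori_pitchfork[OF \<open>a1 \<noteq> 0\<close>] mult_pos_neg simp del: One_nat_def)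
  next
    fix \<nu> :: real assume \<nu>: "0 < a1" "\<nu> < 0"
    then show "\<exists>T. invariant_tori n k \<sigma> C 1 (coeffs1 a1 \<nu>) = {T} \<and>
        asymptotically_stable (closed_leaf n k \<sigma> C)
          (leaf_normal_form n k \<sigma> C 1 (coeffs1 a1 \<nu>) \<omega> (\<lambda>i j. b i j \<nu>)) {origin} \<and>
        repelling (closed_leaf n k \<sigma> C)
          (leaf_normal_form n k \<sigma> C 1 (coeffs1 a1 \<nu>) \<omega> (\<lambda>i j. b i j \<nu>)) T"
      using pitchfork_origin_asymptotically_stable[OF \<nu>(2,1)] pitchfork_torus_repelling[OF \<nu>(2,1)]
      by (auto simp: invariant_tori_pitchfork[OF \<open>a1 \<noteq> 0\<close>] mult_neg_pos simp del: One_nat_def)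
  qed
qed

end
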